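(* Suppose the Böttcher case ($p_0=p_1=0$) and that $X_1$ has a tail of index $\theta>2$, i.e. $\mathbf{P}(X_1\ge x)\sim ax^{-\theta}$ as $x\to\infty$ for some $a>0$. If $\varepsilon_n>0$ satisfy $\varepsilon_nm^{n/2}n^{-1/(2\beta)}\to\infty$, then \[\lim_{n\to\infty}\varepsilon_n^\theta m^{(\theta-1)n}\mathbf{P}(R_n\ge\varepsilon_n)=aI_\theta,\qquad I_\theta:=\frac1{\Gamma(\theta-1)}\int_0^\infty\varphi(v)v^{\theta-2}\,dv.\]
   Context: Standing setup: $Z=(Z_n)_{n\ge0}$ is a Galton–Watson process with $Z_0=1$ and offspring law $\{p_k\}$ with mean $m\in(1,\infty)$ and $\mathbf{E}Z_1\log Z_1<\infty$. Independently, $(X_n)$ are i.i.d. with $\mathbf{E}X_1=0$, $\mathbf{E}X_1^2\in(0,\infty)$; $S_k:=X_1+\dots+X_k$; $R_n:=S_{Z_n}/Z_n$ on $\{Z_n>0\}$, and $\mathbf{P}(R_n\ge x)$ means $\mathbf{P}(R_n\ge x,Z_n>0)$. Böttcher case: $p_0+p_1=0$; $\mu:=\min\{k:p_k>0\}\ge2$ and $\beta\in(0,1)$ is defined by $\mu=m^\beta$. $W:=\lim_nm^{-n}Z_n$ a.s. and $\varphi(h):=\mathbf{E}e^{-hW}$. *)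

theory Defs
  imports "HOL-Probability.Probability"
begin

fun gw_Z :: "(nat \<Rightarrow> nat \<Rightarrow> 'a \<Rightarrow> nat) \<Rightarrow> nat \<Rightarrow> 'a \<Rightarrow> nat" where
  "gw_Z \<xi> 0 \<omega> = 1"
| "gw_Z \<xi> (Suc n) \<omega> = (\<Sum>i<gw_Z \<xi> n \<omega>. \<xi> n i \<omega>)"

definition gw_mean :: "nat pmf \<Rightarrow> real" where
  "gw_mean p = measure_pmf.expectation p real"

definition gw_mu :: "nat pmf \<Rightarrow> nat" where
  "gw_mu p = (LEAST k. pmf p k > 0)"

definition gw_beta :: "nat pmf \<Rightarrow> real" where
  "gw_beta p = ln (real (gw_mu p)) / ln (gw_mean p)"

text \<open>W = lim m^{-n} Z_n (pointwise limit; it exists a.s.).\<close>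
definition gw_W :: "(nat \<Rightarrow> nat \<Rightarrow> 'a \<Rightarrow> nat) \<Rightarrow> real \<Rightarrow> 'a \<Rightarrow> real" where
  "gw_W \<xi> m \<omega> = lim (\<lambda>n. real (gw_Z \<xi> n \<omega>) / m ^ n)"

text \<open>Random walk S_k = X_1 + ... + X_k (the X's indexed from 0).\<close>
definition rw_S :: "(nat \<Rightarrow> 'a \<Rightarrow> real) \<Rightarrow> nat \<Rightarrow> 'a \<Rightarrow> real" where
  "rw_S X k \<omega> = (\<Sum>i<k. X i \<omega>)"

definition gw_R :: "(nat \<Rightarrow> nat \<Rightarrow> 'a \<Rightarrow> nat) \<Rightarrow> (nat \<Rightarrow> 'a \<Rightarrow> real) \<Rightarrow> nat \<Rightarrow> 'a \<Rightarrow> real" where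
  "gw_R \<xi> X n \<omega> = rw_S X (gw_Z \<xi> n \<omega>) \<omega> / real (gw_Z \<xi> n \<omega>)"

text \<open>Joint family of all driving variables (offspring counts and the X's), as reals,
  used to express mutual independence of everything.\<close>
definition gw_family :: "(nat \<Rightarrow> nat \<Rightarrow> 'a \<Rightarrow> nat) \<Rightarrow> (nat \<Rightarrow> 'a \<Rightarrow> real) \<Rightarrow> (nat \<times> nat) + nat \<Rightarrow> 'a \<Rightarrow> real" where
  "gw_family \<xi> X j \<omega> = (case j of Inl (n, i) \<Rightarrow> real (\<xi> n i \<omega>) | Inr k \<Rightarrow> X k \<omega>)"

end

theory Submission
  imports Defs "HOL-Real_Asymp.Real_Asymp"
begin

text \<open>
  Conditioning on \<open>Z n = k\<close> reduces the claim to the tail of a centred random walk. In the regime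
  \<open>y\<^sup>2 \<ge> N k ln k\<close> one big jump dominates: \<open>P(S k \<ge> y) = (a + o(1)) k y powr (- \<theta>)\<close>, uniformly in \<open>y\<close>.
  Inserting \<open>y = \<epsilon> n * k\<close>, the normalised probability becomes \<open>a E (Z n / m ^ n) powr (1 - \<theta>)\<close>, up to
  the contribution of generations with \<open>(\<epsilon> n)\<^sup>2 * Z n = O(n)\<close>.

  Both remaining points rest on a bound for the Laplace transforms \<open>lap n v = E exp (- v Z n / m ^ n)\<close>
  that is uniform in \<open>n\<close>. Since the offspring generating function satisfies \<open>gf s \<le> s ^ \<mu>\<close>, one has
  \<open>lap (n + 1) (m v) \<le> lap n v ^ \<mu>\<close>, and \<open>lap n v \<le> exp (- c v powr \<beta>)\<close> for \<open>v \<ge> 1\<close> follows by induction from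
  \<open>sup lap n 1 < 1\<close>, i.e. from the nondegeneracy of \<open>W\<close>. This makes small generations
  superexponentially unlikely, and it dominates the integrands in
  \<open>\<Gamma>(q) E (Z n / m ^ n) powr (- q) = \<integral> lap n v * v powr (q - 1) dv\<close>.
\<close>

section \<open>Large deviations of heavy-tailed random walks\<close>

text \<open>The growth condition on \<open>\<epsilon>\<close> is where the two estimates meet. With
  \<open>y = \<epsilon> n * k\<close> the jump regime reads
  \<open>(\<epsilon> n)^2 * k >= N * ln k\<close>, so \<open>Z n / m ^ n\<close> has to exceed a
  level \<open>x\<close> of order \<open>n / ((\<epsilon> n)^2 * m ^ n)\<close>. Below it only the
  trivial bound 1 for the tail of the walk is used, hence the probability of a small generation
  alone must beat the factor \<open>m powr ((\<theta> - 1) * n)\<close>. Exponential Markov bounds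
  this probability by \<open>exp (v * x - c * v powr \<beta>)\<close>. To gain an arbitrarily large
  multiple of \<open>n\<close> one takes \<open>v\<close> of order
  \<open>n powr (1 / \<beta>)\<close>, and the loss \<open>v * x\<close> stays below
  \<open>n\<close> once \<open>(\<epsilon> n)^2 * m ^ n\<close> is a large multiple of
  \<open>n powr (1 / \<beta>)\<close>; the condition on \<open>\<epsilon>\<close> is the square root
  of this requirement.

  The number of summands is random, so a limit theorem along a fixed sequence \<open>k n\<close> is
  not enough: the jump estimate is needed uniformly over all large \<open>k\<close> and all
  admissible \<open>y\<close>.\<close>

lemma (in prob_space) indep_vars_reindex:
  assumes "indep_vars N Y UNIV" and "inj f"
  shows "indep_vars (\<lambda>i. N (f i)) (\<lambda>i. Y (f i)) UNIV"
proof -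
  have "indep_vars (\<lambda>j. PiM {f j} N) (\<lambda>j \<omega>. restrict (\<lambda>i. Y i \<omega>) {f j}) UNIV"
    by (rule indep_vars_restrict[OF assms(1)])
       (use assms(2) in \<open>auto simp: disjoint_family_on_def inj_def\<close>)
  then have "indep_vars (\<lambda>i. N (f i)) (\<lambda>j \<omega>. (\<lambda>y. y (f j)) (restrict (\<lambda>i. Y i \<omega>) {f j})) UNIV"
    by (rule indep_vars_compose2) simp
  then show ?thesis by simp
qed

lemma (in prob_space) indep_vars_sum_square:
  fixes Y :: "'i \<Rightarrow> 'a \<Rightarrow> real"
  assumes indep: "indep_vars (\<lambda>_. borel) Y I" and "finite I"
    and int: "\<And>i. i \<in> I \<Longrightarrow> integrable M (Y i)"
    and sq: "\<And>i. i \<in> I \<Longrightarrow> integrable M (\<lambda>\<omega>. (Y i \<omega>)\<^sup>2)"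
    and mean: "\<And>i. i \<in> I \<Longrightarrow> expectation (Y i) = 0"
  shows "integrable M (\<lambda>\<omega>. (\<Sum>i\<in>I. Y i \<omega>)\<^sup>2) \<and>
         expectation (\<lambda>\<omega>. (\<Sum>i\<in>I. Y i \<omega>)\<^sup>2) = (\<Sum>i\<in>I. expectation (\<lambda>\<omega>. (Y i \<omega>)\<^sup>2))"
  using \<open>finite I\<close> indep int sq mean
proof (induction I)
  case empty
  then show ?case by simp
next
  case (insert i I)
  have IH: "integrable M (\<lambda>\<omega>. (\<Sum>i\<in>I. Y i \<omega>)\<^sup>2)"
      "expectation (\<lambda>\<omega>. (\<Sum>i\<in>I. Y i \<omega>)\<^sup>2) = (\<Sum>i\<in>I. expectation (\<lambda>\<omega>. (Y i \<omega>)\<^sup>2))"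
    using insert.IH[OF indep_vars_subset[OF insert.prems(1)]] insert.prems by auto
  have ind: "indep_var borel (Y i) borel (\<lambda>\<omega>. \<Sum>i\<in>I. Y i \<omega>)"
    using insert by (intro indep_vars_sum) auto
  have cross: "integrable M (\<lambda>\<omega>. Y i \<omega> * (\<Sum>i\<in>I. Y i \<omega>))"
      "expectation (\<lambda>\<omega>. Y i \<omega> * (\<Sum>i\<in>I. Y i \<omega>)) = 0"
    using insert.prems
    by (auto intro!: indep_var_integrable[OF ind] simp: indep_var_lebesgue_integral[OF ind])
  have "(\<lambda>\<omega>. (\<Sum>i\<in>insert i I. Y i \<omega>)\<^sup>2) =
      (\<lambda>\<omega>. (Y i \<omega>)\<^sup>2 + 2 * (Y i \<omega> * (\<Sum>i\<in>I. Y i \<omega>)) + (\<Sum>i\<in>I. Y i \<omega>)\<^sup>2)"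
    using insert.hyps by (auto simp: power2_eq_square algebra_simps)
  then show ?case
    using IH cross insert.prems(3)[of i] insert.hyps by simp
qed

text \<open>The big-jump events ask something of one summand and something of all the others
  jointly. So \<open>X i\<close> has to be separated from a whole restricted vector, and
  \<open>B\<close> is a set of such vectors.\<close>

lemma (in prob_space) prob_indep_vars_single:
  fixes X :: "'i \<Rightarrow> 'a \<Rightarrow> real"
  assumes indep: "indep_vars (\<lambda>_. borel) X UNIV" and "i \<notin> I"
    and A: "A \<in> sets borel" and B: "B \<in> sets (PiM I (\<lambda>_. borel))"
  shows "prob {\<omega>\<in>space M. X i \<omega> \<in> A \<and> restrict (\<lambda>j. X j \<omega>) I \<in> B} =
         prob {\<omega>\<in>space M. X i \<omega> \<in> A} * prob {\<omega>\<in>space M. restrict (\<lambda>j. X j \<omega>) I \<in> B}"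
proof -
  have "indep_var (PiM {i} (\<lambda>_. borel)) (\<lambda>\<omega>. restrict (\<lambda>i. X i \<omega>) {i})
          (PiM I (\<lambda>_. borel)) (\<lambda>\<omega>. restrict (\<lambda>i. X i \<omega>) I)"
    by (rule indep_var_restrict[OF indep]) (use \<open>i \<notin> I\<close> in auto)
  moreover have "{f \<in> space (PiM {i} (\<lambda>_. borel)). f i \<in> A} \<in> sets (PiM {i} (\<lambda>_. borel))"
    using A by measurable
  ultimately have "prob ((\<lambda>\<omega>. (restrict (\<lambda>i. X i \<omega>) {i}, restrict (\<lambda>i. X i \<omega>) I)) -`
        ({f \<in> space (PiM {i} (\<lambda>_. borel)). f i \<in> A} \<times> B) \<inter> space M) =
      prob ((\<lambda>\<omega>. restrict (\<lambda>i. X i \<omega>) {i}) -` {f \<in> space (PiM {i} (\<lambda>_. borel)). f i \<in> A} \<inter> space M) *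
      prob ((\<lambda>\<omega>. restrict (\<lambda>i. X i \<omega>) I) -` B \<inter> space M)"
    using B by (intro indep_varD)
  moreover have "(\<lambda>\<omega>. (restrict (\<lambda>i. X i \<omega>) {i}, restrict (\<lambda>i. X i \<omega>) I)) -`
        ({f \<in> space (PiM {i} (\<lambda>_. borel)). f i \<in> A} \<times> B) \<inter> space M =
      {\<omega>\<in>space M. X i \<omega> \<in> A \<and> restrict (\<lambda>j. X j \<omega>) I \<in> B}"
    "(\<lambda>\<omega>. restrict (\<lambda>i. X i \<omega>) {i}) -` {f \<in> space (PiM {i} (\<lambda>_. borel)). f i \<in> A} \<inter> space M
      = {\<omega>\<in>space M. X i \<omega> \<in> A}"
    "(\<lambda>\<omega>. restrict (\<lambda>i. X i \<omega>) I) -` B \<inter> space M = {\<omega>\<in>space M. restrict (\<lambda>j. X j \<omega>) I \<in> B}"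
    by (auto simp: space_PiM)
  ultimately show ?thesis by simp
qed

section \<open>Non-asymptotic bounds for centred i.i.d. walks\<close>

locale centered_iid = prob_space M for M :: "'a measure" +
  fixes X :: "nat \<Rightarrow> 'a \<Rightarrow> real"
  assumes indep: "indep_vars (\<lambda>_. borel) X UNIV"
    and ident: "\<And>k. distr M borel (X k) = distr M borel (X 0)"
    and X_int: "integrable M (X 0)" and X_mean: "expectation (X 0) = 0"
    and X_sq: "integrable M (\<lambda>\<omega>. (X 0 \<omega>)\<^sup>2)"
begin

lemma X_rv [measurable]: "X k \<in> borel_measurable M"
  using indep by (auto simp: indep_vars_def)

definition tailp :: "real \<Rightarrow> real" where
  "tailp x = prob {\<omega>\<in>space M. X 0 \<omega> \<ge> x}"

definition sigma2 :: real where
  "sigma2 = expectation (\<lambda>\<omega>. (X 0 \<omega>)\<^sup>2)"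

lemma sigma2_nonneg: "sigma2 \<ge> 0"
  unfolding sigma2_def by simp

lemma tailp_nonneg: "tailp x \<ge> 0"
  unfolding tailp_def by simp

lemma tailp_eq: "prob {\<omega>\<in>space M. X k \<omega> \<ge> x} = tailp x"
proof -
  have *: "measure (distr M borel (X k)) {x..} = prob {\<omega>\<in>space M. X k \<omega> \<ge> x}" for k
    by (subst measure_distr) (auto intro!: arg_cong[where f="prob"])
  show ?thesis using *[of k] *[of 0] by (simp add: tailp_def ident[of k])
qed

lemma ident_integral:
  fixes g :: "real \<Rightarrow> real"
  assumes [measurable]: "g \<in> borel_measurable borel"
  shows "expectation (\<lambda>\<omega>. g (X k \<omega>)) = expectation (\<lambda>\<omega>. g (X 0 \<omega>))"
    and "integrable M (\<lambda>\<omega>. g (X k \<omega>)) \<longleftrightarrow> integrable M (\<lambda>\<omega>. g (X 0 \<omega>))"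
proof -
  have "expectation (\<lambda>\<omega>. g (X k \<omega>)) = integral\<^sup>L (distr M borel (X k)) g" for k
    by (subst integral_distr) auto
  from this[of k] this[of 0] show "expectation (\<lambda>\<omega>. g (X k \<omega>)) = expectation (\<lambda>\<omega>. g (X 0 \<omega>))"
    by (simp add: ident[of k])
  have "integrable M (\<lambda>\<omega>. g (X k \<omega>)) \<longleftrightarrow> integrable (distr M borel (X k)) g" for k
    by (subst integrable_distr_eq) auto
  from this[of k] this[of 0] show "integrable M (\<lambda>\<omega>. g (X k \<omega>)) \<longleftrightarrow> integrable M (\<lambda>\<omega>. g (X 0 \<omega>))"
    by (simp add: ident[of k])
qed

text \<open>The index set is arbitrary because the bound is applied to the walk with one summand
  removed.\<close>

lemma sum_Chebyshev:
  assumes "finite I" "d > 0"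
  shows "prob {\<omega>\<in>space M. \<bar>\<Sum>i\<in>I. X i \<omega>\<bar> \<ge> d} \<le> card I * sigma2 / d\<^sup>2"
proof -
  have X: "integrable M (X i)" "expectation (X i) = 0" "integrable M (\<lambda>\<omega>. (X i \<omega>)\<^sup>2)"
      "expectation (\<lambda>\<omega>. (X i \<omega>)\<^sup>2) = sigma2" for i
    using ident_integral[of "\<lambda>x. x" i] ident_integral[of "\<lambda>x. x\<^sup>2" i] X_int X_sq X_mean
    by (simp_all add: sigma2_def)
  have *: "integrable M (\<lambda>\<omega>. (\<Sum>i\<in>I. X i \<omega>)\<^sup>2) \<and>
         expectation (\<lambda>\<omega>. (\<Sum>i\<in>I. X i \<omega>)\<^sup>2) = (\<Sum>i\<in>I. expectation (\<lambda>\<omega>. (X i \<omega>)\<^sup>2))"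
    using X assms by (intro indep_vars_sum_square indep_vars_subset[OF indep]) auto
  have "prob {\<omega>\<in>space M. (\<Sum>i\<in>I. X i \<omega>)\<^sup>2 \<ge> d\<^sup>2} \<le> expectation (\<lambda>\<omega>. (\<Sum>i\<in>I. X i \<omega>)\<^sup>2) / d\<^sup>2"
    using * assms by (intro integral_Markov_inequality_measure[where A="{}"]) auto
  moreover have "{\<omega>\<in>space M. (\<Sum>i\<in>I. X i \<omega>)\<^sup>2 \<ge> d\<^sup>2} = {\<omega>\<in>space M. \<bar>\<Sum>i\<in>I. X i \<omega>\<bar> \<ge> d}"
    using assms(2) by (auto simp: abs_le_square_iff[symmetric])
  moreover have "expectation (\<lambda>\<omega>. (\<Sum>i\<in>I. X i \<omega>)\<^sup>2) = card I * sigma2"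
    using * X(4) by simp
  ultimately show ?thesis by (simp only:)
qed

text \<open>The events ``\<open>X i\<close> is the only jump above \<open>(1 + \<delta>) y\<close> and the others sum to at least \<open>- \<delta> y\<close>''
  are disjoint, so no inclusion-exclusion is needed.\<close>

lemma walk_lower:
  assumes "y > 0" "\<delta> > 0"
  shows "prob {\<omega>\<in>space M. rw_S X k \<omega> \<ge> y} \<ge>
     k * tailp ((1 + \<delta>) * y) * (1 - k * tailp ((1 + \<delta>) * y) - k * sigma2 / (\<delta> * y)\<^sup>2)"
proof -
  define s where "s = (1 + \<delta>) * y"
  define J where "J i = {..<k} - {i}" for i
  define B where "B i = {f \<in> space (PiM (J i) (\<lambda>_. borel :: real measure)). (\<forall>j\<in>J i. f j < s) \<and> (\<Sum>j\<in>J i. f j) \<ge> - (\<delta> * y)}" for i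
  define E where "E i = {\<omega>\<in>space M. X i \<omega> \<in> {s..} \<and> restrict (\<lambda>j. X j \<omega>) (J i) \<in> B i}" for i
  have fin [simp]: "finite (J i)" and iJ: "i \<notin> J i" for i by (simp_all add: J_def)
  have [measurable]: "B i \<in> sets (PiM (J i) (\<lambda>_. borel))" for i
    unfolding B_def by measurable
  have resB: "restrict (\<lambda>j. X j \<omega>) (J i) \<in> B i \<longleftrightarrow> (\<forall>j\<in>J i. X j \<omega> < s) \<and> (\<Sum>j\<in>J i. X j \<omega>) \<ge> - (\<delta> * y)" for i \<omega>
    by (auto simp: B_def space_PiM)
  have E_alt: "E i = {\<omega>\<in>space M. X i \<omega> \<ge> s \<and> (\<forall>j\<in>J i. X j \<omega> < s) \<and> (\<Sum>j\<in>J i. X j \<omega>) \<ge> - (\<delta> * y)}" for i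
    unfolding E_def resB by auto
  have [measurable]: "E i \<in> events" for i
    unfolding E_alt by measurable
  have PB: "prob {\<omega>\<in>space M. restrict (\<lambda>j. X j \<omega>) (J i) \<in> B i} \<ge> 1 - k * tailp s - k * sigma2 / (\<delta> * y)\<^sup>2" if "i < k" for i
  proof -
    let ?G = "{\<omega>\<in>space M. (\<forall>j\<in>J i. X j \<omega> < s) \<and> (\<Sum>j\<in>J i. X j \<omega>) \<ge> - (\<delta> * y)}"
    have card: "real (card (J i)) \<le> k"
      using card_mono[of "{..<k}" "J i"] by (simp add: J_def)
    have "1 - prob ?G = prob (space M - ?G)"
      by (rule prob_compl[symmetric]) measurable
    also have "\<dots> \<le> prob ((\<Union>j\<in>J i. {\<omega>\<in>space M. X j \<omega> \<ge> s}) \<union> {\<omega>\<in>space M. \<bar>\<Sum>j\<in>J i. X j \<omega>\<bar> \<ge> \<delta> * y})"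
      by (intro finite_measure_mono) (auto simp: not_less)
    also have "\<dots> \<le> prob (\<Union>j\<in>J i. {\<omega>\<in>space M. X j \<omega> \<ge> s}) + prob {\<omega>\<in>space M. \<bar>\<Sum>j\<in>J i. X j \<omega>\<bar> \<ge> \<delta> * y}"
      by (intro measure_Un_le) auto
    also have "prob (\<Union>j\<in>J i. {\<omega>\<in>space M. X j \<omega> \<ge> s}) \<le> (\<Sum>j\<in>J i. prob {\<omega>\<in>space M. X j \<omega> \<ge> s})"
      by (intro finite_measure_subadditive_finite) auto
    also have "prob {\<omega>\<in>space M. \<bar>\<Sum>j\<in>J i. X j \<omega>\<bar> \<ge> \<delta> * y} \<le> card (J i) * sigma2 / (\<delta> * y)\<^sup>2"
      using assms by (intro sum_Chebyshev) auto
    also have "(\<Sum>j\<in>J i. prob {\<omega>\<in>space M. X j \<omega> \<ge> s}) = (\<Sum>j\<in>J i. tailp s)"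
      by (simp add: tailp_eq)
    also have "(\<Sum>j\<in>J i. tailp s) \<le> k * tailp s"
      using card tailp_nonneg[of s] by (simp add: mult_right_mono)
    also have "card (J i) * sigma2 / (\<delta> * y)\<^sup>2 \<le> k * sigma2 / (\<delta> * y)\<^sup>2"
      using card sigma2_nonneg by (intro mult_right_mono divide_right_mono) auto
    finally show ?thesis by (simp add: resB)
  qed
  have PE: "prob (E i) \<ge> tailp s * (1 - k * tailp s - k * sigma2 / (\<delta> * y)\<^sup>2)" if "i < k" for i
  proof -
    have "prob (E i) = tailp s * prob {\<omega>\<in>space M. restrict (\<lambda>j. X j \<omega>) (J i) \<in> B i}"
      unfolding E_def using prob_indep_vars_single[OF indep iJ, of "{s..}" "B i"] tailp_eq[of s i] by simp
    then show ?thesis using PB[OF that] tailp_nonneg[of s] by (simp add: mult_left_mono)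
  qed
  have "k * tailp s * (1 - k * tailp s - k * sigma2 / (\<delta> * y)\<^sup>2) \<le> (\<Sum>i<k. prob (E i))"
    using sum_mono[of "{..<k}" "\<lambda>i. tailp s * (1 - k * tailp s - k * sigma2 / (\<delta> * y)\<^sup>2)" "\<lambda>i. prob (E i)"] PE
    by simp
  also have "\<dots> = prob (\<Union>i<k. E i)"
  proof (rule finite_measure_finite_Union[symmetric])
    show "disjoint_family_on E {..<k}"
      by (force simp: disjoint_family_on_def E_alt J_def)
  qed auto
  also have "\<dots> \<le> prob {\<omega>\<in>space M. rw_S X k \<omega> \<ge> y}"
  proof (rule finite_measure_mono)
    show "(\<Union>i<k. E i) \<subseteq> {\<omega>\<in>space M. rw_S X k \<omega> \<ge> y}"
    proof
      fix \<omega> assume "\<omega> \<in> (\<Union>i<k. E i)"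
      then obtain i where i: "i < k" "\<omega> \<in> E i" by auto
      have "rw_S X k \<omega> = X i \<omega> + (\<Sum>j\<in>J i. X j \<omega>)"
        unfolding rw_S_def J_def using i(1) by (intro sum.remove) auto
      also have "\<dots> \<ge> y" using i(2) by (auto simp: E_alt s_def algebra_simps)
      finally show "\<omega> \<in> {\<omega>\<in>space M. rw_S X k \<omega> \<ge> y}" using i(2) by (auto simp: E_alt)
    qed
  qed (simp add: rw_S_def)
  finally show ?thesis by (simp add: s_def)
qed

text \<open>If the sum reaches \<open>y\<close> and no jump reaches
  \<open>(1 - \<delta>) * y\<close>, then either some jump is at least \<open>z\<close> and the
  remaining summands must contribute at least \<open>\<delta> * y\<close>, or every jump is below
  \<open>z\<close>. In the first case the jump is independent of the remaining sum, so Chebyshev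
  supplies a small extra factor. The level \<open>z\<close> is left free until the last probability
  is estimated.\<close>

lemma walk_upper:
  assumes "y > 0" "\<delta> > 0"
  shows "prob {\<omega>\<in>space M. rw_S X k \<omega> \<ge> y} \<le>
     k * tailp ((1 - \<delta>) * y) + k * tailp z * (k * sigma2 / (\<delta> * y)\<^sup>2)
       + prob {\<omega>\<in>space M. (\<forall>i<k. X i \<omega> < z) \<and> rw_S X k \<omega> \<ge> y}"
proof -
  define J where "J i = {..<k} - {i}" for i
  define B where "B i = {f \<in> space (PiM (J i) (\<lambda>_. borel :: real measure)). (\<Sum>j\<in>J i. f j) \<ge> \<delta> * y}" for i
  define E where "E i = {\<omega>\<in>space M. X i \<omega> \<in> {z..} \<and> restrict (\<lambda>j. X j \<omega>) (J i) \<in> B i}" for i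
  define A where "A i = {\<omega>\<in>space M. X i \<omega> \<ge> (1 - \<delta>) * y}" for i
  define C where "C = {\<omega>\<in>space M. (\<forall>i<k. X i \<omega> < z) \<and> rw_S X k \<omega> \<ge> y}"
  have fin [simp]: "finite (J i)" and iJ: "i \<notin> J i" for i by (simp_all add: J_def)
  have [measurable]: "B i \<in> sets (PiM (J i) (\<lambda>_. borel))" for i
    unfolding B_def by measurable
  have resB: "restrict (\<lambda>j. X j \<omega>) (J i) \<in> B i \<longleftrightarrow> (\<Sum>j\<in>J i. X j \<omega>) \<ge> \<delta> * y" for i \<omega>
    by (auto simp: B_def space_PiM)
  have E_alt: "E i = {\<omega>\<in>space M. X i \<omega> \<ge> z \<and> (\<Sum>j\<in>J i. X j \<omega>) \<ge> \<delta> * y}" for i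
    unfolding E_def resB by auto
  have [measurable]: "E i \<in> events" "A i \<in> events" "C \<in> events" for i
    unfolding E_alt A_def C_def rw_S_def by measurable
  have PE: "prob (E i) \<le> tailp z * (k * sigma2 / (\<delta> * y)\<^sup>2)" if "i < k" for i
  proof -
    have card: "real (card (J i)) \<le> k"
      using card_mono[of "{..<k}" "J i"] by (simp add: J_def)
    have "prob {\<omega>\<in>space M. restrict (\<lambda>j. X j \<omega>) (J i) \<in> B i} \<le> prob {\<omega>\<in>space M. \<bar>\<Sum>j\<in>J i. X j \<omega>\<bar> \<ge> \<delta> * y}"
      unfolding resB by (intro finite_measure_mono) auto
    also have "\<dots> \<le> card (J i) * sigma2 / (\<delta> * y)\<^sup>2"
      using assms by (intro sum_Chebyshev) auto
    also have "\<dots> \<le> k * sigma2 / (\<delta> * y)\<^sup>2"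
      using card sigma2_nonneg by (auto intro!: mult_right_mono divide_right_mono)
    finally have "prob {\<omega>\<in>space M. restrict (\<lambda>j. X j \<omega>) (J i) \<in> B i} \<le> k * sigma2 / (\<delta> * y)\<^sup>2" .
    moreover have "prob (E i) = tailp z * prob {\<omega>\<in>space M. restrict (\<lambda>j. X j \<omega>) (J i) \<in> B i}"
      unfolding E_def using prob_indep_vars_single[OF indep iJ, of "{z..}" "B i"] tailp_eq[of z i] by simp
    ultimately show ?thesis using tailp_nonneg[of z] by (simp only: mult_left_mono)
  qed
  have "{\<omega>\<in>space M. rw_S X k \<omega> \<ge> y} \<subseteq> ((\<Union>i<k. A i) \<union> (\<Union>i<k. E i)) \<union> C"
  proof
    fix \<omega> assume w: "\<omega> \<in> {\<omega>\<in>space M. rw_S X k \<omega> \<ge> y}"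
    show "\<omega> \<in> ((\<Union>i<k. A i) \<union> (\<Union>i<k. E i)) \<union> C"
    proof (rule ccontr)
      assume *: "\<omega> \<notin> ((\<Union>i<k. A i) \<union> (\<Union>i<k. E i)) \<union> C"
      then have A: "X i \<omega> < (1 - \<delta>) * y" and E: "X i \<omega> \<ge> z \<Longrightarrow> (\<Sum>j\<in>J i. X j \<omega>) < \<delta> * y" if "i < k" for i
        using that w by (fastforce simp: A_def E_alt not_le)+
      have "\<not> (\<forall>i<k. X i \<omega> < z)" using * w by (auto simp: C_def)
      then obtain i where i: "i < k" "X i \<omega> \<ge> z" by (auto simp: not_less)
      have "rw_S X k \<omega> = X i \<omega> + (\<Sum>j\<in>J i. X j \<omega>)"
        unfolding rw_S_def J_def using i(1) by (intro sum.remove) auto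
      also have "\<dots> < (1 - \<delta>) * y + \<delta> * y"
        by (intro add_strict_mono A E i)
      also have "\<dots> = y" by (simp add: algebra_simps)
      finally show False using w by simp
    qed
  qed
  then have "prob {\<omega>\<in>space M. rw_S X k \<omega> \<ge> y} \<le> prob (((\<Union>i<k. A i) \<union> (\<Union>i<k. E i)) \<union> C)"
    by (rule finite_measure_mono) measurable
  also have "\<dots> \<le> prob ((\<Union>i<k. A i) \<union> (\<Union>i<k. E i)) + prob C"
    by (rule measure_Un_le) auto
  also have "prob ((\<Union>i<k. A i) \<union> (\<Union>i<k. E i)) \<le> prob (\<Union>i<k. A i) + prob (\<Union>i<k. E i)"
    by (rule measure_Un_le) auto
  also have "prob (\<Union>i<k. A i) \<le> (\<Sum>i<k. prob (A i))"
    by (rule finite_measure_subadditive_finite) auto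
  also have "(\<Sum>i<k. prob (A i)) = k * tailp ((1 - \<delta>) * y)"
    by (simp add: A_def tailp_eq)
  also have "prob (\<Union>i<k. E i) \<le> (\<Sum>i<k. prob (E i))"
    by (rule finite_measure_subadditive_finite) auto
  also have "(\<Sum>i<k. prob (E i)) \<le> (\<Sum>i<k. tailp z * (k * sigma2 / (\<delta> * y)\<^sup>2))"
    by (rule sum_mono) (use PE in auto)
  finally show ?thesis by (simp add: C_def)
qed

text \<open>Below \<open>1 / h\<close> the exponential lies under a parabola, whose linear term
  vanishes in the mean. The range from \<open>1 / h\<close> to \<open>z\<close> is cut again at
  \<open>g * z\<close>: the full factor \<open>exp (h * z)\<close> is affordable only against the
  probability of exceeding a multiple of \<open>z\<close>, and \<open>tailp (1 / h)\<close> gets the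
  smaller factor \<open>exp (g * (h * z))\<close>. The parabola is nonnegative on the whole line, so
  it may stay in the majorant outside its own range.\<close>

lemma truncated_exp_moment:
  assumes h: "h > 0"
  shows "integrable M (\<lambda>\<omega>. exp (h * X i \<omega>) * indicator {..<z} (X i \<omega>))"
    and "expectation (\<lambda>\<omega>. exp (h * X i \<omega>) * indicator {..<z} (X i \<omega>)) \<le>
      1 + h\<^sup>2 * sigma2 + exp (g * (h * z)) * tailp (1 / h) + exp (h * z) * tailp (g * z)"
proof -
  show int: "integrable M (\<lambda>\<omega>. exp (h * X i \<omega>) * indicator {..<z} (X i \<omega>))" for i
    using h by (intro integrable_const_bound[where B="exp (h * z)"]) (auto simp: indicator_def)
  have "exp (h * x) * indicator {..<z} x \<le>
      1 + h * x + h\<^sup>2 * x\<^sup>2 + exp (g * (h * z)) * indicator {1/h..} x + exp (h * z) * indicator {g*z..} x" for x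
  proof -
    have pos: "1 + h * x + h\<^sup>2 * x\<^sup>2 \<ge> 0"
    proof -
      have "1 + h * x + h\<^sup>2 * x\<^sup>2 = (1 + h * x / 2)\<^sup>2 + 3 / 4 * (h * x)\<^sup>2"
        by (simp add: power2_eq_square algebra_simps)
      also have "\<dots> \<ge> 0" by simp
      finally show ?thesis .
    qed
    have n: "exp (g * (h * z)) * indicator {1/h..} x \<ge> 0" "exp (h * z) * indicator {g*z..} x \<ge> 0" by simp_all
    have l: "exp (h * x) * indicator {..<z} x = exp (h * x)" if "x < z" using that by simp
    consider "x \<ge> z" | "x < z" "h * x < 1" | "x < z" "h * x \<ge> 1" "x < g * z" | "x < z" "x \<ge> g * z" "h * x \<ge> 1" by linarith
    then show ?thesis
    proof cases
      case 1
      then have "exp (h * x) * indicator {..<z} x = 0" by simp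
      then show ?thesis using pos n by linarith
    next
      case 2
      \<comment> \<open>For \<open>u = h * x < 0\<close> combine \<open>exp u <= 1 / (1 - u)\<close>
        with \<open>(1 + u + u^2) * (1 - u) = 1 - u^3 >= 1\<close>.\<close>
      have "exp (h * x) \<le> 1 + h * x + (h * x)\<^sup>2"
      proof (cases "h * x \<ge> 0")
        case True then show ?thesis using exp_bound[of "h * x"] 2 by simp
      next
        case False
        have "1 - (- (h * x)) + (h*x)\<^sup>2 \<ge> exp (h * x)"
        proof -
          have "exp (h * x) = 1 / exp (-(h*x))" by (simp add: exp_minus field_simps)
          also have "\<dots> \<le> 1 / (1 - h * x)"
            using exp_ge_add_one_self[of "-(h*x)"] False by (intro divide_left_mono mult_pos_pos) auto
          also have "\<dots> \<le> 1 + h * x + (h*x)\<^sup>2"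
          proof -
            have "(1 + h * x + (h*x)\<^sup>2) * (1 - h * x) = 1 - (h*x)^3"
              by (simp add: algebra_simps power2_eq_square power3_eq_cube)
            moreover have "(h*x)^3 \<le> 0" using False by (simp add: power_le_zero_eq)
            ultimately show ?thesis using False by (simp add: field_simps)
          qed
          finally show ?thesis by simp
        qed
        then show ?thesis by simp
      qed
      then have "exp (h * x) \<le> 1 + h * x + h\<^sup>2 * x\<^sup>2" by (simp only: power_mult_distrib)
      then show ?thesis using l 2 n by linarith
    next
      case 3
      then have "h * x \<le> h * (g * z)" using h by (intro mult_left_mono) auto
      then have "exp (h * x) \<le> exp (g * (h * z))" by (simp add: algebra_simps)
      moreover have "1 / h \<le> x" using 3 h by (simp add: field_simps)
      then have "exp (g * (h * z)) * indicator {1/h..} x = exp (g * (h * z))" by simp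
      ultimately show ?thesis using 3 pos l n by linarith
    next
      case 4
      then have "h * x \<le> h * z" using h by (intro mult_left_mono) auto
      then have "exp (h * x) \<le> exp (h * z)" by simp
      moreover have "exp (h * z) * indicator {g*z..} x = exp (h * z)" using 4 by simp
      ultimately show ?thesis using 4 pos l n by linarith
    qed
  qed
  note pw = this
  have ind: "integrable M (\<lambda>\<omega>. indicator {c..} (X 0 \<omega>) :: real)"
      "expectation (\<lambda>\<omega>. indicator {c..} (X 0 \<omega>)) = tailp c" for c
  proof -
    show "integrable M (\<lambda>\<omega>. indicator {c..} (X 0 \<omega>) :: real)"
      by (rule integrable_const_bound[where B=1]) (auto simp: indicator_def)
    have "expectation (\<lambda>\<omega>. indicator {c..} (X 0 \<omega>)) = expectation (indicator {\<omega>\<in>space M. X 0 \<omega> \<ge> c} :: 'a \<Rightarrow> real)"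
      by (rule Bochner_Integration.integral_cong) (auto simp: indicator_def)
    then show "expectation (\<lambda>\<omega>. indicator {c..} (X 0 \<omega>)) = tailp c"
      by (simp add: tailp_def)
  qed
  have "expectation (\<lambda>\<omega>. exp (h * X i \<omega>) * indicator {..<z} (X i \<omega>)) =
     expectation (\<lambda>\<omega>. exp (h * X 0 \<omega>) * indicator {..<z} (X 0 \<omega>))"
    by (rule ident_integral(1)[of "\<lambda>x. exp (h * x) * indicator {..<z} x"]) simp
  also have "\<dots> \<le> expectation (\<lambda>\<omega>. 1 + h * X 0 \<omega> + h\<^sup>2 * (X 0 \<omega>)\<^sup>2 +
      exp (g * (h * z)) * indicator {1/h..} (X 0 \<omega>) + exp (h * z) * indicator {g*z..} (X 0 \<omega>))"
    using ind(1) X_int X_sq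
    by (intro integral_mono int pw Bochner_Integration.integrable_add integrable_mult_right) auto
  also have "\<dots> = 1 + h\<^sup>2 * sigma2 + exp (g * (h * z)) * tailp (1 / h) + exp (h * z) * tailp (g * z)"
    using ind X_int X_sq X_mean by (simp add: prob_space sigma2_def)
  finally show "expectation (\<lambda>\<omega>. exp (h * X i \<omega>) * indicator {..<z} (X i \<omega>)) \<le>
      1 + h\<^sup>2 * sigma2 + exp (g * (h * z)) * tailp (1 / h) + exp (h * z) * tailp (g * z)" .
qed

text \<open>Exponential Markov inequality. The truncation enters as an indicator inside each factor,
  so the majorant of the restricted event is still a product of independent variables.\<close>

lemma truncated_walk_Chernoff:
  assumes h: "h > 0"
  shows "prob {\<omega>\<in>space M. (\<forall>i<k. X i \<omega> < z) \<and> rw_S X k \<omega> \<ge> y} \<le>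
     exp (- h * y) * (1 + h\<^sup>2 * sigma2 + exp (g * (h * z)) * tailp (1 / h) + exp (h * z) * tailp (g * z)) ^ k"
proof -
  let ?Y = "\<lambda>i \<omega>. exp (h * X i \<omega>) * indicator {..<z} (X i \<omega>) :: real"
  define E where "E = {\<omega>\<in>space M. (\<forall>i<k. X i \<omega> < z) \<and> rw_S X k \<omega> \<ge> y}"
  have ind: "indep_vars (\<lambda>_. borel) ?Y {..<k}"
    by (rule indep_vars_compose2[OF indep_vars_subset[OF indep]]) auto
  have intP: "integrable M (\<lambda>\<omega>. \<Prod>i<k. ?Y i \<omega>)"
    using truncated_exp_moment(1)[OF h] by (intro indep_vars_integrable[OF _ ind]) auto
  have [measurable]: "E \<in> events" unfolding E_def rw_S_def by measurable
  have "prob E = expectation (indicator E)" by simp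
  also have "\<dots> \<le> expectation (\<lambda>\<omega>. exp (- h * y) * (\<Prod>i<k. ?Y i \<omega>))"
  proof (rule integral_mono)
    fix \<omega> assume w: "\<omega> \<in> space M"
    show "indicator E \<omega> \<le> exp (- h * y) * (\<Prod>i<k. ?Y i \<omega>)"
    proof (cases "\<omega> \<in> E")
      case True
      then have lt: "i < k \<Longrightarrow> X i \<omega> < z" and ge: "rw_S X k \<omega> \<ge> y" for i by (auto simp: E_def)
      then have "(\<Prod>i<k. ?Y i \<omega>) = (\<Prod>i<k. exp (h * X i \<omega>))" by (intro prod.cong) auto
      also have "\<dots> = exp (h * rw_S X k \<omega>)"
        by (simp add: exp_sum rw_S_def sum_distrib_left)
      finally have "exp (- h * y) * (\<Prod>i<k. ?Y i \<omega>) = exp (h * (rw_S X k \<omega> - y))"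
        by (simp add: exp_add[symmetric] algebra_simps)
      also have "\<dots> \<ge> 1" using ge h by simp
      finally show ?thesis using True by simp
    next
      case False
      then show ?thesis by (auto intro!: mult_nonneg_nonneg prod_nonneg)
    qed
  qed (use intP in \<open>auto simp: emeasure_eq_measure\<close>)
  also have "\<dots> = exp (- h * y) * (\<Prod>i<k. expectation (?Y i))"
    using indep_vars_lebesgue_integral[OF _ ind] truncated_exp_moment(1)[OF h] by simp
  also have "\<dots> \<le> exp (- h * y) * (\<Prod>i<k. 1 + h\<^sup>2 * sigma2 + exp (g * (h * z)) * tailp (1 / h) + exp (h * z) * tailp (g * z))"
    using truncated_exp_moment(2)[OF h, of _ z g]
    by (intro mult_left_mono prod_mono) (auto intro!: integral_nonneg_AE)
  finally show ?thesis by (simp add: E_def)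
qed

end

section \<open>Real asymptotics in the regime \<open>k ln k = o(y^2)\<close>\<close>

locale walk_regime =
  fixes k :: "'b \<Rightarrow> nat" and y :: "'b \<Rightarrow> real" and F :: "'b filter"
  assumes k_lim: "filterlim k at_top F"
    and y_pos: "\<forall>\<^sub>F n in F. y n > 0"
    and growth: "filterlim (\<lambda>n. (y n)\<^sup>2 / (k n * ln (k n))) at_top F"
begin

lemma k_real_lim: "filterlim (\<lambda>n. real (k n)) at_top F"
  by (rule filterlim_compose[OF filterlim_real_sequentially k_lim])

lemma k_ge: "\<forall>\<^sub>F n in F. k n \<ge> N"
  using k_lim by (auto simp: filterlim_at_top)

lemma kln_over_y2: "((\<lambda>n. k n * ln (k n) / (y n)\<^sup>2) \<longlongrightarrow> 0) F"
  using tendsto_inverse_0_at_top[OF growth] by (simp add: inverse_eq_divide)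

lemma y_lim: "filterlim y at_top F"
proof (rule filterlim_at_top_mono)
  show "filterlim (\<lambda>n. sqrt (k n)) at_top F"
    by (rule filterlim_compose[OF sqrt_at_top k_real_lim])
  have "\<forall>\<^sub>F n in F. (y n)\<^sup>2 / (k n * ln (k n)) \<ge> 1"
    using growth by (auto simp: filterlim_at_top)
  then show "\<forall>\<^sub>F n in F. sqrt (k n) \<le> y n"
    using y_pos k_ge[of 3]
  proof eventually_elim
    case (elim n)
    have "1 \<le> ln (3::real)" using ln3_gt_1 by simp
    also have "\<dots> \<le> ln (k n)" using elim by simp
    finally have l: "ln (real (k n)) \<ge> 1" .
    have "real (k n) * 1 \<le> k n * ln (k n)" using l by (intro mult_left_mono) auto
    also have "\<dots> \<le> (y n)\<^sup>2" using elim l by (simp add: field_simps)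
    finally show ?case using elim by (simp add: real_le_lsqrt)
  qed
qed

lemma k_over_y2: "((\<lambda>n. k n / (y n)\<^sup>2) \<longlongrightarrow> 0) F"
proof -
  have "((\<lambda>n. k n * ln (k n) / (y n)\<^sup>2 * inverse (ln (k n))) \<longlongrightarrow> 0 * 0) F"
    by (intro tendsto_mult kln_over_y2 tendsto_inverse_0_at_top
        filterlim_compose[OF ln_at_top k_real_lim])
  moreover have "\<forall>\<^sub>F n in F. k n * ln (k n) / (y n)\<^sup>2 * inverse (ln (k n)) = k n / (y n)\<^sup>2"
    using k_ge[of 2]
  proof eventually_elim
    case (elim n)
    then have "ln (real (k n)) > 0" by simp
    then show ?case by simp
  qed
  ultimately show ?thesis using Lim_transform_eventually by fastforce
qed

text \<open>The regime controls \<open>ln k\<close>, while the Chernoff exponent involves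
  \<open>ln y\<close>. If \<open>ln y <= 2 * ln k\<close> the two are comparable; otherwise
  \<open>k\<close> is below \<open>y powr (1/2)\<close> and the quotient vanishes for that reason
  alone.\<close>

lemma k_lny_over_y2: "((\<lambda>n. k n * ln (y n) / (y n)\<^sup>2) \<longlongrightarrow> 0) F"
proof (rule tendsto_sandwich[OF _ _ tendsto_const])
  have "((\<lambda>x::real. ln x * x powr (1/2) / x\<^sup>2) \<longlongrightarrow> 0) at_top" by real_asymp
  from filterlim_compose[OF this y_lim]
  have "((\<lambda>n. 2 * (k n * ln (k n) / (y n)\<^sup>2) + ln (y n) * y n powr (1/2) / (y n)\<^sup>2) \<longlongrightarrow> 2 * 0 + 0) F"
    by (intro tendsto_intros kln_over_y2)
  then show "((\<lambda>n. 2 * (k n * ln (k n) / (y n)\<^sup>2) + ln (y n) * y n powr (1/2) / (y n)\<^sup>2) \<longlongrightarrow> 0) F"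
    by simp
  have "\<forall>\<^sub>F n in F. y n \<ge> 1" using y_lim by (auto simp: filterlim_at_top)
  then show "\<forall>\<^sub>F n in F. 0 \<le> k n * ln (y n) / (y n)\<^sup>2"
    by eventually_elim simp
  have "\<forall>\<^sub>F n in F. y n \<ge> 1" using y_lim by (auto simp: filterlim_at_top)
  then show "\<forall>\<^sub>F n in F. k n * ln (y n) / (y n)\<^sup>2 \<le> 2 * (k n * ln (k n) / (y n)\<^sup>2) + ln (y n) * y n powr (1/2) / (y n)\<^sup>2"
    using k_ge[of 1]
  proof eventually_elim
    case (elim n)
    have k1: "real (k n) \<ge> 1" using elim by simp
    have "k n * ln (y n) \<le> 2 * (k n * ln (k n)) + ln (y n) * y n powr (1/2)"
    proof (cases "ln (y n) \<le> 2 * ln (k n)")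
      case True
      then have "k n * ln (y n) \<le> k n * (2 * ln (k n))" by (intro mult_left_mono) auto
      moreover have "ln (y n) * y n powr (1/2) \<ge> 0" using elim by simp
      ultimately show ?thesis by simp
    next
      case False
      then have "ln (k n) \<le> ln (y n powr (1/2))" using elim by (simp add: ln_powr)
      then have "k n \<le> y n powr (1/2)" using k1 elim by (subst (asm) ln_le_cancel_iff) auto
      then have "k n * ln (y n) \<le> y n powr (1/2) * ln (y n)" using elim by (intro mult_right_mono) auto
      moreover have "k n * ln (k n) \<ge> 0" using k1 by simp
      ultimately show ?thesis by (simp add: mult.commute)
    qed
    then have "k n * ln (y n) / (y n)\<^sup>2 \<le> (2 * (k n * ln (k n)) + ln (y n) * y n powr (1/2)) / (y n)\<^sup>2"
      by (rule divide_right_mono) simp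
    then show ?case by (simp add: add_divide_distrib)
  qed
qed

text \<open>This is the order of the expected number of jumps exceeding a fixed multiple of
  \<open>y\<close>. Since it vanishes, a second big jump and the walk without big jumps are both
  negligible.\<close>

lemma k_y_powr:
  assumes "\<theta> > 2"
  shows "((\<lambda>n. k n * y n powr (-\<theta>)) \<longlongrightarrow> 0) F"
proof -
  have "((\<lambda>x::real. x powr (2-\<theta>)) \<longlongrightarrow> 0) at_top" using assms by real_asymp
  from filterlim_compose[OF this y_lim]
  have "((\<lambda>n. k n / (y n)\<^sup>2 * y n powr (2 - \<theta>)) \<longlongrightarrow> 0 * 0) F"
    by (intro tendsto_mult k_over_y2)
  moreover have "\<forall>\<^sub>F n in F. k n / (y n)\<^sup>2 * y n powr (2 - \<theta>) = k n * y n powr (-\<theta>)"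
    using y_pos by eventually_elim (simp add: powr_diff powr_minus field_simps)
  ultimately show ?thesis using Lim_transform_eventually by fastforce
qed

end

section \<open>The one-big-jump limit and its uniform version\<close>

locale heavy_tailed_iid = centered_iid +
  fixes a \<theta> :: real
  assumes a_pos: "a > 0" and \<theta>_gt: "\<theta> > 2"
    and tail: "((\<lambda>x. tailp x * x powr \<theta>) \<longlongrightarrow> a) at_top"
begin

lemma tailp_scaled:
  assumes y: "filterlim y at_top F" and "c > 0"
  shows "((\<lambda>n. tailp (c * y n) * y n powr \<theta>) \<longlongrightarrow> a * c powr (-\<theta>)) F"
proof -
  have "filterlim (\<lambda>n. c * y n) at_top F"
    by (rule filterlim_tendsto_pos_mult_at_top[OF tendsto_const \<open>c > 0\<close> y])
  from filterlim_compose[OF tail this]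
  have lim: "((\<lambda>n. tailp (c * y n) * (c * y n) powr \<theta> * c powr (-\<theta>)) \<longlongrightarrow> a * c powr (-\<theta>)) F"
    by (intro tendsto_intros)
  have "\<forall>\<^sub>F n in F. y n > 0" using y by (auto simp: filterlim_at_top_dense)
  then have "\<forall>\<^sub>F n in F. tailp (c * y n) * (c * y n) powr \<theta> * c powr (-\<theta>) = tailp (c * y n) * y n powr \<theta>"
    by eventually_elim (use \<open>c > 0\<close> in \<open>simp add: powr_mult powr_minus field_simps\<close>)
  with lim show ?thesis by (rule Lim_transform_eventually)
qed

lemma tailp_le: "\<forall>\<^sub>F x in at_top. tailp x \<le> 2 * a * x powr (-\<theta>)"
proof -
  have "\<forall>\<^sub>F x in at_top. tailp x * x powr \<theta> < 2 * a"
    using order_tendstoD(2)[OF tail, of "2 * a"] a_pos by simp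
  then show ?thesis using eventually_gt_at_top[of 0]
    by eventually_elim (simp add: powr_minus field_simps)
qed

context
  fixes k :: "'b \<Rightarrow> nat" and y :: "'b \<Rightarrow> real" and F :: "'b filter"
  assumes reg: "walk_regime k y F"
begin

interpretation walk_regime k y F by (rule reg)

text \<open>The Chernoff parameter \<open>h\<close> is chosen such that \<open>exp (h z) = z powr \<theta> / k\<close> for \<open>z = y / 3\<close>; the tail
  contribution to the exponential moment is then \<open>O(1 / k)\<close>, while the quadratic contribution
  \<open>k h\<^sup>2\<close> is at most \<open>h z\<close> because \<open>k ln y = o(y\<^sup>2)\<close>.\<close>

lemma truncated_walk_bound:
  "\<exists>C. \<forall>\<^sub>F n in F. prob {\<omega>\<in>space M. (\<forall>i<k n. X i \<omega> < y n / 3) \<and> rw_S X (k n) \<omega> \<ge> y n} * y n powr \<theta> / k n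
      \<le> C * (k n * y n powr (-\<theta>))"
proof -
  \<comment> \<open>Chosen so that \<open>g * \<theta> = (\<theta> - 2) / 2\<close>. As
    \<open>u <= \<theta> * ln z\<close>, this gives
    \<open>exp (g * u) <= z powr ((\<theta> - 2) / 2)\<close>, which exactly offsets
    \<open>h powr (\<theta> - 2)\<close> for \<open>h <= z powr (-1/2)\<close>. Hence the middle
    range costs only \<open>2 * a * h^2\<close> and can be merged with the variance term in
    \<open>C1\<close>.\<close>
  define g where "g = (\<theta> - 2) / (2 * \<theta>)"
  define C1 where "C1 = sigma2 + 2 * a"
  define C2 where "C2 = 2 * a * g powr (-\<theta>)"
  \<comment> \<open>With \<open>z = y / 3\<close> the Chernoff factor is
    \<open>exp (- 3 * u)\<close>. One \<open>u\<close> pays for the quadratic term, and the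
    remaining \<open>exp (- 2 * u)\<close> is the square of \<open>k * z powr (-\<theta>)\<close>,
    that is, one power more than the main term. With \<open>y / 2\<close> the same computation would
    leave a bound of the order of the main term itself.\<close>
  define z where "z n = y n / 3" for n
  have g: "g > 0" using \<theta>_gt by (simp add: g_def)
  have C1: "C1 > 0" using a_pos sigma2_nonneg by (simp add: C1_def)
  have C2: "C2 \<ge> 0" using a_pos by (simp add: C2_def)
  have z_lim: "filterlim z at_top F"
    using filterlim_tendsto_pos_mult_at_top[OF tendsto_const[of "1/3"] _ y_lim] by (simp add: z_def[abs_def])
  have q1: "filterlim (\<lambda>x::real. x / (\<theta> * ln x)) at_top at_top" using \<theta>_gt by real_asymp
  obtain x0 where x0: "\<And>x. x \<ge> x0 \<Longrightarrow> tailp x \<le> 2 * a * x powr (-\<theta>)"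
    using tailp_le by (auto simp: eventually_at_top_linorder)
  have e1: "\<forall>\<^sub>F n in F. z n / (\<theta> * ln (z n)) \<ge> x0"
    using filterlim_compose[OF q1 z_lim] by (auto simp: filterlim_at_top)
  have "\<forall>\<^sub>F x in at_top. \<theta> * ln x \<le> x powr (1/2)" using \<theta>_gt by real_asymp
  from eventually_compose_filterlim[OF this z_lim]
  have e2: "\<forall>\<^sub>F n in F. \<theta> * ln (z n) \<le> z n powr (1/2)" .
  have e3: "\<forall>\<^sub>F n in F. g * z n \<ge> x0" "\<forall>\<^sub>F n in F. z n \<ge> 3"
    using filterlim_tendsto_pos_mult_at_top[OF tendsto_const g z_lim] z_lim by (auto simp: filterlim_at_top)
  have e4: "\<forall>\<^sub>F n in F. k n / (y n)\<^sup>2 < 1 / 9"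
    using order_tendstoD(2)[OF k_over_y2, of "1/9"] by simp
  have "((\<lambda>n. C1 * \<theta> * 9 * (k n * ln (y n) / (y n)\<^sup>2)) \<longlongrightarrow> C1 * \<theta> * 9 * 0) F"
    by (intro tendsto_intros k_lny_over_y2)
  then have e5: "\<forall>\<^sub>F n in F. C1 * \<theta> * 9 * (k n * ln (y n) / (y n)\<^sup>2) < 1"
    by (intro order_tendstoD(2)[where y=0]) auto
  have "\<forall>\<^sub>F n in F. prob {\<omega>\<in>space M. (\<forall>i<k n. X i \<omega> < y n / 3) \<and> rw_S X (k n) \<omega> \<ge> y n} * y n powr \<theta> / k n
      \<le> exp C2 * 9 powr \<theta> * (k n * y n powr (-\<theta>))"
    using e1 e2 e3 e4 e5 k_ge[of 1] y_pos
  proof eventually_elim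
    case (elim n)
    define u where "u = ln (z n powr \<theta> / k n)"
    define h where "h = u / z n"
    have zp: "z n > 0" and z3: "z n \<ge> 3" using elim by auto
    have kp: "real (k n) \<ge> 1" using elim by simp
    have yz: "y n = 3 * z n" by (simp add: z_def)
    have ueq: "u = \<theta> * ln (z n) - ln (k n)"
      unfolding u_def using zp kp by (subst ln_div) (auto simp: ln_powr)
    have lnz: "ln (z n) > 0" using z3 by simp
    have u_le: "u \<le> \<theta> * ln (z n)" unfolding ueq using kp by simp
    \<comment> \<open>The bound \<open>1 / 9\<close> in \<open>e4\<close> is tuned to
      \<open>z = y / 3\<close>. From \<open>k <= z^2\<close> one gets
      \<open>u >= (\<theta> - 2) * ln z\<close>, so that \<open>h\<close> is positive.\<close>
    have "real (k n) \<le> (z n)\<^sup>2" using elim zp by (simp add: yz field_simps)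
    then have "ln (real (k n)) \<le> ln ((z n)\<^sup>2)" using kp zp by (subst ln_le_cancel_iff) auto
    also have "\<dots> = 2 * ln (z n)" using zp by (simp add: ln_realpow)
    finally have "u \<ge> (\<theta> - 2) * ln (z n)" unfolding ueq by (simp add: algebra_simps)
    then have u_pos: "u > 0" using lnz \<theta>_gt by (smt (verit) mult_pos_pos)
    then have h_pos: "h > 0" using zp by (simp add: h_def)
    have hz: "h * z n = u" using zp by (simp add: h_def)
    have exp_u: "exp u = z n powr \<theta> / k n" unfolding u_def using zp kp by simp
    have "1 / h = z n / u" by (simp add: h_def)
    also have "\<dots> \<ge> z n / (\<theta> * ln (z n))"
      using u_le u_pos zp lnz \<theta>_gt by (intro divide_left_mono mult_pos_pos) auto
    finally have h_x0: "1 / h \<ge> x0" using elim by simp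
    have V1: "tailp (1 / h) \<le> 2 * a * h powr \<theta>"
      using x0[OF h_x0] h_pos by (simp add: powr_minus powr_divide)
    have t1: "exp (g * u) * tailp (1 / h) \<le> 2 * a * h\<^sup>2"
    proof -
      have "g * u \<le> g * (\<theta> * ln (z n))" using u_le g by (intro mult_left_mono) auto
      also have "\<dots> = (\<theta> - 2) / 2 * ln (z n)" using \<theta>_gt by (simp add: g_def)
      finally have "exp (g * u) \<le> exp ((\<theta> - 2) / 2 * ln (z n))" by simp
      also have "\<dots> = (z n powr (1/2)) powr (\<theta> - 2)" using zp by (simp add: powr_def)
      finally have "exp (g * u) \<le> (z n powr (1/2)) powr (\<theta> - 2)" .
      moreover have "h powr (\<theta> - 2) \<le> (1 / z n powr (1/2)) powr (\<theta> - 2)"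
      proof (rule powr_mono2)
        have "u \<le> z n powr (1/2)" using u_le elim by linarith
        then have "h \<le> z n powr (1/2) / z n" unfolding h_def using zp by (intro divide_right_mono) auto
        also have "\<dots> = 1 / z n powr (1/2)"
        proof -
          have "z n = z n powr (1/2) * z n powr (1/2)" using zp by (simp add: powr_add[symmetric])
          then show ?thesis using zp by (metis divide_divide_eq_left divide_self_if less_irrefl powr_eq_0_iff)
        qed
        finally show "h \<le> 1 / z n powr (1/2)" .
      qed (use h_pos \<theta>_gt in auto)
      ultimately have "exp (g * u) * h powr (\<theta> - 2) \<le> (z n powr (1/2)) powr (\<theta> - 2) * (1 / z n powr (1/2)) powr (\<theta> - 2)"
        by (intro mult_mono) auto
      also have "\<dots> = 1" using zp by (simp add: powr_divide)
      finally have *: "exp (g * u) * h powr (\<theta> - 2) \<le> 1" .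
      have "exp (g * u) * tailp (1 / h) \<le> exp (g * u) * (2 * a * h powr \<theta>)"
        using V1 by (intro mult_left_mono) auto
      also have "h powr \<theta> = h powr (\<theta> - 2) * h\<^sup>2"
        using h_pos by (simp add: powr_diff)
      also have "exp (g * u) * (2 * a * (h powr (\<theta> - 2) * h\<^sup>2)) = (exp (g * u) * h powr (\<theta> - 2)) * (2 * a * h\<^sup>2)"
        by simp
      also have "\<dots> \<le> 1 * (2 * a * h\<^sup>2)" using * a_pos by (intro mult_right_mono) auto
      finally show ?thesis by simp
    qed
    have t2: "exp u * tailp (g * z n) \<le> C2 / k n"
    proof -
      have "exp u * tailp (g * z n) \<le> exp u * (2 * a * (g * z n) powr (-\<theta>))"
        using x0 elim by (intro mult_left_mono) auto
      also have "\<dots> = C2 / k n"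
        unfolding exp_u C2_def using zp g by (simp add: powr_mult powr_minus field_simps)
      finally show ?thesis .
    qed
    have t3: "k n * C1 * h\<^sup>2 \<le> u"
    proof -
      have "ln (z n) \<le> ln (y n)" using yz zp by simp
      then have "u \<le> \<theta> * ln (y n)" using u_le \<theta>_gt by (smt (verit) mult_left_mono)
      then have "C1 * 9 * (k n / (y n)\<^sup>2) * u \<le> C1 * 9 * (k n / (y n)\<^sup>2) * (\<theta> * ln (y n))"
        using C1 by (intro mult_left_mono) auto
      also have "\<dots> \<le> 1" using elim by (simp add: field_simps)
      finally have "C1 * 9 * (k n / (y n)\<^sup>2) * u * u \<le> 1 * u" using u_pos by (intro mult_right_mono) auto
      moreover have "C1 * 9 * (k n / (y n)\<^sup>2) * u * u = k n * C1 * h\<^sup>2"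
        unfolding h_def yz using zp by (simp add: power2_eq_square field_simps)
      ultimately show ?thesis by simp
    qed
    have "prob {\<omega>\<in>space M. (\<forall>i<k n. X i \<omega> < z n) \<and> rw_S X (k n) \<omega> \<ge> y n} \<le>
      exp (- h * y n) * (1 + h\<^sup>2 * sigma2 + exp (g * (h * z n)) * tailp (1 / h) + exp (h * z n) * tailp (g * z n)) ^ k n"
      by (rule truncated_walk_Chernoff[OF h_pos])
    also have "\<dots> \<le> exp (- h * y n) * exp (C1 * h\<^sup>2 + C2 / k n) ^ k n"
    proof (intro mult_left_mono power_mono)
      have "1 + h\<^sup>2 * sigma2 + exp (g * (h * z n)) * tailp (1 / h) + exp (h * z n) * tailp (g * z n) \<le> 1 + (C1 * h\<^sup>2 + C2 / k n)"
        using t1 t2 unfolding hz C1_def by (simp add: algebra_simps)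
      also have "\<dots> \<le> exp (C1 * h\<^sup>2 + C2 / k n)" by (rule exp_ge_add_one_self)
      finally show "1 + h\<^sup>2 * sigma2 + exp (g * (h * z n)) * tailp (1 / h) + exp (h * z n) * tailp (g * z n) \<le> exp (C1 * h\<^sup>2 + C2 / k n)" .
      show "0 \<le> 1 + h\<^sup>2 * sigma2 + exp (g * (h * z n)) * tailp (1 / h) + exp (h * z n) * tailp (g * z n)"
        using sigma2_nonneg tailp_nonneg by (intro add_nonneg_nonneg mult_nonneg_nonneg) auto
    qed auto
    also have "\<dots> = exp (- (3 * u) + k n * C1 * h\<^sup>2 + C2)"
    proof -
      have "h * y n = 3 * u" using hz yz by simp
      moreover have "exp (C1 * h\<^sup>2 + C2 / k n) ^ k n = exp (k n * C1 * h\<^sup>2 + C2)"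
        using kp by (simp add: exp_of_nat_mult[symmetric] algebra_simps)
      ultimately show ?thesis by (simp add: exp_add[symmetric])
    qed
    also have "\<dots> \<le> exp (C2 - 2 * u)" using t3 by simp
    also have "\<dots> = exp C2 * (k n * z n powr (-\<theta>))\<^sup>2"
    proof -
      have "exp (2 * u) = (exp u)\<^sup>2" by (simp add: power2_eq_square exp_add[symmetric])
      then show ?thesis unfolding exp_diff exp_u using zp kp by (simp add: powr_minus field_simps power2_eq_square)
    qed
    also have "\<dots> = exp C2 * 9 powr \<theta> * (k n * y n powr (-\<theta>))\<^sup>2"
    proof -
      have "z n powr (-\<theta>) = 3 powr \<theta> * y n powr (-\<theta>)"
        using elim by (simp add: z_def powr_divide powr_minus field_simps)
      moreover have "(3 powr \<theta>)\<^sup>2 = (9::real) powr \<theta>"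
        by (simp add: power2_eq_square powr_mult[symmetric])
      ultimately show ?thesis by (simp add: power_mult_distrib algebra_simps)
    qed
    finally have "prob {\<omega>\<in>space M. (\<forall>i<k n. X i \<omega> < z n) \<and> rw_S X (k n) \<omega> \<ge> y n} * y n powr \<theta> / k n \<le>
        exp C2 * 9 powr \<theta> * (k n * y n powr (-\<theta>))\<^sup>2 * y n powr \<theta> / k n"
      by (intro divide_right_mono mult_right_mono) auto
    also have "\<dots> = exp C2 * 9 powr \<theta> * (k n * y n powr (-\<theta>))"
      using elim kp by (simp add: power2_eq_square powr_minus field_simps)
    finally show ?case by (simp add: z_def)
  qed
  then show ?thesis by blast
qed

text \<open>For fixed \<open>\<delta>\<close> the normalised bounds of \<open>walk_lower\<close> and
  \<open>walk_upper\<close> converge to \<open>a * (1 + \<delta>) powr (-\<theta>)\<close> and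
  \<open>a * (1 - \<delta>) powr (-\<theta>)\<close>; then \<open>\<delta>\<close> tends to
  0.\<close>

lemma walk_large_deviation:
  "((\<lambda>n. prob {\<omega>\<in>space M. rw_S X (k n) \<omega> \<ge> y n} * y n powr \<theta> / k n) \<longlongrightarrow> a) F"
proof -
  let ?r = "\<lambda>n. prob {\<omega>\<in>space M. rw_S X (k n) \<omega> \<ge> y n} * y n powr \<theta> / k n"
  have cheb: "((\<lambda>n. k n * sigma2 / (\<delta> * y n)\<^sup>2) \<longlongrightarrow> 0) F" for \<delta>
  proof -
    have "((\<lambda>n. sigma2 / \<delta>\<^sup>2 * (k n / (y n)\<^sup>2)) \<longlongrightarrow> sigma2 / \<delta>\<^sup>2 * 0) F"
      by (intro tendsto_intros k_over_y2)
    then show ?thesis by (simp add: power_mult_distrib mult.commute)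
  qed
  have low: "\<forall>\<^sub>F n in F. ?r n > l" if "l < a * (1 + \<delta>) powr (-\<theta>)" "\<delta> > 0" for l \<delta>
  proof -
    let ?v = "\<lambda>n. tailp ((1 + \<delta>) * y n) * y n powr \<theta>"
    let ?lo = "\<lambda>n. ?v n * (1 - ?v n * (k n * y n powr (-\<theta>)) - k n * sigma2 / (\<delta> * y n)\<^sup>2)"
    have v: "(?v \<longlongrightarrow> a * (1 + \<delta>) powr (-\<theta>)) F"
      using that by (intro tailp_scaled y_lim) auto
    have "(?lo \<longlongrightarrow> a * (1 + \<delta>) powr (-\<theta>) * (1 - a * (1 + \<delta>) powr (-\<theta>) * 0 - 0)) F"
      by (intro tendsto_intros v cheb k_y_powr \<theta>_gt)
    then have "\<forall>\<^sub>F n in F. ?lo n > l" using that by (intro order_tendstoD(1)) auto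
    then show ?thesis using y_pos k_ge[of 1]
    proof eventually_elim
      case (elim n)
      have c: "y n powr \<theta> * y n powr (-\<theta>) = 1" using elim by (simp add: powr_add[symmetric])
      have "?v n * (k n * y n powr (-\<theta>)) = k n * tailp ((1 + \<delta>) * y n)"
        using c by simp
      then have "?lo n = k n * tailp ((1 + \<delta>) * y n) * (1 - k n * tailp ((1 + \<delta>) * y n) - k n * sigma2 / (\<delta> * y n)\<^sup>2) * y n powr \<theta> / k n"
        using elim by simp
      also have "\<dots> \<le> ?r n"
        using walk_lower[of "y n" \<delta> "k n"] elim that
        by (intro divide_right_mono mult_right_mono) auto
      finally show ?case using elim by linarith
    qed
  qed
  obtain C where C: "\<forall>\<^sub>F n in F. prob {\<omega>\<in>space M. (\<forall>i<k n. X i \<omega> < y n / 3) \<and> rw_S X (k n) \<omega> \<ge> y n} * y n powr \<theta> / k n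
      \<le> C * (k n * y n powr (-\<theta>))"
    using truncated_walk_bound by blast
  have up: "\<forall>\<^sub>F n in F. ?r n < u" if "u > a * (1 - \<delta>) powr (-\<theta>)" "\<delta> > 0" "\<delta> < 1" for u \<delta>
  proof -
    let ?v = "\<lambda>n. tailp ((1 - \<delta>) * y n) * y n powr \<theta>" and ?w = "\<lambda>n. tailp (1/3 * y n) * y n powr \<theta>"
    let ?hi = "\<lambda>n. ?v n + ?w n * (k n * sigma2 / (\<delta> * y n)\<^sup>2) + C * (k n * y n powr (-\<theta>))"
    have v: "(?v \<longlongrightarrow> a * (1 - \<delta>) powr (-\<theta>)) F" "(?w \<longlongrightarrow> a * (1/3) powr (-\<theta>)) F"
      using that by (intro tailp_scaled y_lim; simp)+
    have "(?hi \<longlongrightarrow> a * (1 - \<delta>) powr (-\<theta>) + a * (1/3) powr (-\<theta>) * 0 + C * 0) F"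
      by (intro tendsto_intros v cheb k_y_powr \<theta>_gt)
    then have "\<forall>\<^sub>F n in F. ?hi n < u" using that by (intro order_tendstoD(2)) auto
    then show ?thesis using y_pos k_ge[of 1] C
    proof eventually_elim
      case (elim n)
      have "?r n \<le> (k n * tailp ((1 - \<delta>) * y n) + k n * tailp (y n / 3) * (k n * sigma2 / (\<delta> * y n)\<^sup>2)
       + prob {\<omega>\<in>space M. (\<forall>i<k n. X i \<omega> < y n / 3) \<and> rw_S X (k n) \<omega> \<ge> y n}) * y n powr \<theta> / k n"
        using walk_upper[of "y n" \<delta> "k n" "y n / 3"] elim that
        by (intro divide_right_mono mult_right_mono) auto
      also have "\<dots> = ?v n + ?w n * (k n * sigma2 / (\<delta> * y n)\<^sup>2)
          + prob {\<omega>\<in>space M. (\<forall>i<k n. X i \<omega> < y n / 3) \<and> rw_S X (k n) \<omega> \<ge> y n} * y n powr \<theta> / k n"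
        using elim by (simp add: distrib_right add_divide_distrib)
      finally show ?case using elim by linarith
    qed
  qed
  show ?thesis
  proof (rule order_tendstoI)
    fix l assume "l < a"
    have "((\<lambda>\<delta>. a * (1 + \<delta>) powr (-\<theta>)) \<longlongrightarrow> a * (1 + 0) powr (-\<theta>)) (at_right 0)"
      by (intro tendsto_intros) auto
    then have "\<forall>\<^sub>F \<delta> in at_right 0. l < a * (1 + \<delta>) powr (-\<theta>)"
      using \<open>l < a\<close> by (intro order_tendstoD(1)) auto
    then have "\<forall>\<^sub>F \<delta> in at_right 0. l < a * (1 + \<delta>) powr (-\<theta>) \<and> \<delta> > 0"
      using eventually_at_right_less by eventually_elim auto
    then obtain \<delta> where "l < a * (1 + \<delta>) powr (-\<theta>)" "\<delta> > 0"
      using eventually_happens'[OF trivial_limit_at_right_real] by blast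
    then show "\<forall>\<^sub>F n in F. ?r n > l" by (rule low)
  next
    fix u assume "u > a"
    have "((\<lambda>\<delta>. a * (1 - \<delta>) powr (-\<theta>)) \<longlongrightarrow> a * (1 - 0) powr (-\<theta>)) (at_right 0)"
      by (intro tendsto_intros) auto
    then have "\<forall>\<^sub>F \<delta> in at_right 0. u > a * (1 - \<delta>) powr (-\<theta>)"
      using \<open>u > a\<close> by (intro order_tendstoD(2)) auto
    moreover have "\<forall>\<^sub>F \<delta>::real in at_right 0. \<delta> < 1"
      using eventually_at_right_field by (metis zero_less_one)
    ultimately have "\<forall>\<^sub>F \<delta> in at_right 0. u > a * (1 - \<delta>) powr (-\<theta>) \<and> \<delta> > 0 \<and> \<delta> < 1"
      using eventually_at_right_less by eventually_elim auto
    then obtain \<delta> where "u > a * (1 - \<delta>) powr (-\<theta>)" "\<delta> > 0" "\<delta> < 1"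
      using eventually_happens'[OF trivial_limit_at_right_real] by blast
    then show "\<forall>\<^sub>F n in F. ?r n < u" by (rule up)
  qed
qed

end

text \<open>One number \<open>N\<close> bounds \<open>k\<close> from below and also serves as the
  constant of the regime. Therefore counterexamples for all \<open>N\<close> form a sequence in
  \<open>walk_regime\<close> along which \<open>walk_large_deviation\<close> fails. They are indexed
  by \<open>Suc N\<close> because \<open>N\<close> has to be positive.\<close>

lemma walk_large_deviation_uniform:
  assumes "\<eta> > 0"
  shows "\<exists>N>0. \<forall>k\<ge>N. \<forall>y>0. y\<^sup>2 \<ge> real N * (real k * ln (real k)) \<longrightarrow>
     \<bar>prob {\<omega>\<in>space M. rw_S X k \<omega> \<ge> y} * y powr \<theta> / k - a\<bar> \<le> \<eta>"
proof (rule ccontr)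
  assume neg: "\<not> ?thesis"
  define Q where "Q N k y \<longleftrightarrow> k \<ge> N \<and> y > 0 \<and> y\<^sup>2 \<ge> real N * (real k * ln (real k)) \<and>
     \<not> \<bar>prob {\<omega>\<in>space M. rw_S X k \<omega> \<ge> y} * y powr \<theta> / k - a\<bar> \<le> \<eta>" for N k y
  have "\<exists>k y. Q (Suc N) k y" for N
  proof (rule ccontr)
    assume "\<not> (\<exists>k y. Q (Suc N) k y)"
    then have "\<forall>k\<ge>Suc N. \<forall>y>0. y\<^sup>2 \<ge> real (Suc N) * (real k * ln (real k)) \<longrightarrow>
       \<bar>prob {\<omega>\<in>space M. rw_S X k \<omega> \<ge> y} * y powr \<theta> / k - a\<bar> \<le> \<eta>"
      unfolding Q_def by blast
    with neg show False by blast
  qed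
  then obtain k y where Q: "\<And>N. Q (Suc N) (k N) (y N)" by metis
  have ky: "k N \<ge> Suc N" "y N > 0" "(y N)\<^sup>2 \<ge> real (Suc N) * (real (k N) * ln (real (k N)))"
     "\<not> \<bar>prob {\<omega>\<in>space M. rw_S X (k N) \<omega> \<ge> y N} * y N powr \<theta> / k N - a\<bar> \<le> \<eta>" for N
    using Q[of N] unfolding Q_def by blast+
  have reg: "walk_regime k y sequentially"
  proof
    have "N \<le> k N" for N using ky(1)[of N] by simp
    then show "filterlim k sequentially sequentially"
      unfolding filterlim_at_top eventually_sequentially by (metis order_trans)
    show "filterlim (\<lambda>n. (y n)\<^sup>2 / (k n * ln (k n))) at_top sequentially"
    proof (rule filterlim_at_top_mono[OF filterlim_real_sequentially])
      show "\<forall>\<^sub>F n in sequentially. real n \<le> (y n)\<^sup>2 / (k n * ln (k n))"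
        using eventually_gt_at_top[of 1]
      proof eventually_elim
        case (elim n)
        then have "real (k n) > 1" using ky(1)[of n] by linarith
        then have p: "real (k n) * ln (real (k n)) > 0" by simp
        have "real n * (real (k n) * ln (real (k n))) \<le> real (Suc n) * (real (k n) * ln (real (k n)))"
          using p by (intro mult_right_mono) auto
        also have "\<dots> \<le> (y n)\<^sup>2" by (rule ky(3))
        finally show ?case using p by (simp add: pos_le_divide_eq)
      qed
    qed
  qed (use ky(2) in auto)
  have "\<forall>\<^sub>F n in sequentially. dist (prob {\<omega>\<in>space M. rw_S X (k n) \<omega> \<ge> y n} * y n powr \<theta> / k n) a < \<eta>"
    by (rule tendstoD[OF walk_large_deviation[OF reg] assms])
  then obtain n where "dist (prob {\<omega>\<in>space M. rw_S X (k n) \<omega> \<ge> y n} * y n powr \<theta> / k n) a < \<eta>"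
    by (auto simp: eventually_sequentially)
  with ky(4)[of n] show False by (simp add: dist_real_def)
qed

end

section \<open>The Galton--Watson process\<close>

text \<open>Conditioning on a block of coordinates without conditional expectations: the second
  block is integrated over an independent copy. It serves twice, for one step of the branching
  process and for freezing the generation size before the walk is looked at.\<close>

lemma (in prob_space) indep_vars_restrict_nn_integral:
  assumes indep: "indep_vars N Y UNIV" and disj: "A \<inter> B = {}"
    and g [measurable]: "g \<in> borel_measurable (PiM A N \<Otimes>\<^sub>M PiM B N)"
  shows "(\<integral>\<^sup>+\<omega>. g (restrict (\<lambda>i. Y i \<omega>) A, restrict (\<lambda>i. Y i \<omega>) B) \<partial>M) =
         (\<integral>\<^sup>+\<omega>. \<integral>\<^sup>+\<omega>'. g (restrict (\<lambda>i. Y i \<omega>) A, restrict (\<lambda>i. Y i \<omega>') B) \<partial>M \<partial>M)"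
proof -
  let ?A = "\<lambda>\<omega>. restrict (\<lambda>i. Y i \<omega>) A" and ?B = "\<lambda>\<omega>. restrict (\<lambda>i. Y i \<omega>) B"
  have iv: "indep_var (PiM A N) ?A (PiM B N) ?B"
    by (rule indep_var_restrict[OF indep disj]) auto
  have [measurable]: "?A \<in> measurable M (PiM A N)" "?B \<in> measurable M (PiM B N)"
    using indep_var_rv1[OF iv] indep_var_rv2[OF iv] by simp_all
  interpret B: prob_space "distr M (PiM B N) ?B" by (rule prob_space_distr) simp
  have "(\<integral>\<^sup>+\<omega>. g (?A \<omega>, ?B \<omega>) \<partial>M) = integral\<^sup>N (distr M (PiM A N \<Otimes>\<^sub>M PiM B N) (\<lambda>\<omega>. (?A \<omega>, ?B \<omega>))) g"
    by (subst nn_integral_distr) auto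
  also have "distr M (PiM A N \<Otimes>\<^sub>M PiM B N) (\<lambda>\<omega>. (?A \<omega>, ?B \<omega>)) = distr M (PiM A N) ?A \<Otimes>\<^sub>M distr M (PiM B N) ?B"
    using iv by (simp add: indep_var_distribution_eq)
  also have "integral\<^sup>N \<dots> g = (\<integral>\<^sup>+x. \<integral>\<^sup>+y. g (x, y) \<partial>distr M (PiM B N) ?B \<partial>distr M (PiM A N) ?A)"
    by (rule B.nn_integral_fst[symmetric]) (simp cong: measurable_cong_sets)
  also have "\<dots> = (\<integral>\<^sup>+x. \<integral>\<^sup>+\<omega>'. g (x, ?B \<omega>') \<partial>M \<partial>distr M (PiM A N) ?A)"
    by (intro nn_integral_cong, subst nn_integral_distr) (auto simp: space_PiM)
  also have "\<dots> = (\<integral>\<^sup>+\<omega>. \<integral>\<^sup>+\<omega>'. g (?A \<omega>, ?B \<omega>') \<partial>M \<partial>M)"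
    by (subst nn_integral_distr) auto
  finally show ?thesis .
qed

text \<open>The family and the space are arbitrary because the process is also run on product
  spaces, where the offspring numbers are read off from coordinates.\<close>

lemma measurable_gw_Z:
  assumes "\<And>j i. j < n \<Longrightarrow> \<zeta> j i \<in> measurable N (count_space UNIV)"
  shows "gw_Z \<zeta> n \<in> measurable N (count_space UNIV)"
  using assms
proof (induction n)
  case 0
  have "gw_Z \<zeta> 0 = (\<lambda>_. 1)" by auto
  then show ?case by simp
next
  case (Suc n)
  have [measurable]: "gw_Z \<zeta> n \<in> measurable N (count_space UNIV)" "\<And>i. \<zeta> n i \<in> measurable N (count_space UNIV)"
    using Suc by auto
  have "(\<lambda>\<omega>. \<Sum>i<gw_Z \<zeta> n \<omega>. \<zeta> n i \<omega>) \<in> measurable N (count_space UNIV)"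
    by (rule measurable_compose_countable[where g="gw_Z \<zeta> n"]) measurable
  moreover have "gw_Z \<zeta> (Suc n) = (\<lambda>\<omega>. \<Sum>i<gw_Z \<zeta> n \<omega>. \<zeta> n i \<omega>)" by auto
  ultimately show ?case by (simp only:)
qed

lemma gw_Z_cong:
  assumes "\<And>j i. j < n \<Longrightarrow> \<zeta> j i x = \<xi> j i \<omega>"
  shows "gw_Z \<zeta> n x = gw_Z \<xi> n \<omega>"
  using assms by (induction n) auto

section \<open>Markov property, means and one-step deviations\<close>

locale galton_watson = prob_space M for M :: "'a measure" +
  fixes p :: "nat pmf" and \<xi> :: "nat \<Rightarrow> nat \<Rightarrow> 'a \<Rightarrow> nat"
  assumes \<xi>_meas [measurable]: "\<And>n i. \<xi> n i \<in> measurable M (count_space UNIV)"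
    and \<xi>_law: "\<And>n i. distr M (count_space UNIV) (\<xi> n i) = measure_pmf p"
    and \<xi>_indep: "indep_vars (\<lambda>_. borel) (\<lambda>(n, i) \<omega>. real (\<xi> n i \<omega>)) UNIV"
    and mean_fin: "integrable (measure_pmf p) real"
    and mean_gt1: "gw_mean p > 1"
    and LlogL: "integrable (measure_pmf p) (\<lambda>k. real k * ln (real k))"
    and boettcher: "pmf p 0 = 0" "pmf p 1 = 0"
begin

abbreviation m :: real where "m \<equiv> gw_mean p"
abbreviation Z :: "nat \<Rightarrow> 'a \<Rightarrow> nat" where "Z \<equiv> gw_Z \<xi>"

lemma m_pos: "m > 0" using mean_gt1 by simp

lemma Z_meas [measurable]: "Z n \<in> measurable M (count_space UNIV)"
  by (rule measurable_gw_Z) simp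

lemma \<xi>_nn_integral: "(\<integral>\<^sup>+\<omega>. g (\<xi> n i \<omega>) \<partial>M) = (\<integral>\<^sup>+k. g k \<partial>measure_pmf p)"
  by (subst \<xi>_law[of n i, symmetric], subst nn_integral_distr) auto

lemma \<xi>_integral:
  fixes g :: "nat \<Rightarrow> real"
  shows "expectation (\<lambda>\<omega>. g (\<xi> n i \<omega>)) = measure_pmf.expectation p g"
  by (subst \<xi>_law[of n i, symmetric], subst integral_distr) auto

lemma \<xi>_integrable:
  fixes g :: "nat \<Rightarrow> real"
  shows "integrable M (\<lambda>\<omega>. g (\<xi> n i \<omega>)) \<longleftrightarrow> integrable (measure_pmf p) g"
  by (subst \<xi>_law[of n i, symmetric], subst integrable_distr_eq) auto

lemma \<xi>_row_indep: "indep_vars (\<lambda>_. borel) (\<lambda>i \<omega>. real (\<xi> n i \<omega>)) UNIV"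
  using indep_vars_reindex[OF \<xi>_indep, of "\<lambda>i. (n, i)"] by (simp add: inj_def)

lemma support_ge_2: "k \<in> set_pmf p \<Longrightarrow> k \<ge> 2"
  using boettcher by (metis One_nat_def Suc_1 less_2_cases not_less pmf_eq_0_set_pmf)

lemma AE_\<xi>: "AE \<omega> in M. \<forall>n i. \<xi> n i \<omega> \<ge> 2"
proof -
  have "AE \<omega> in M. \<xi> n i \<omega> \<ge> 2" for n i
  proof -
    have "AE k in distr M (count_space UNIV) (\<xi> n i). k \<ge> 2"
      unfolding \<xi>_law by (rule AE_pmfI) (rule support_ge_2)
    then show ?thesis by (subst (asm) AE_distr_iff) auto
  qed
  then show ?thesis by (simp add: AE_all_countable)
qed

text \<open>In the Boettcher case every individual has at least two children. The bound does not
  depend on the path, so for all large \<open>n\<close> almost every \<open>Z n\<close> lies in the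
  range where the uniform walk estimate holds.\<close>

lemma AE_Z_ge: "AE \<omega> in M. \<forall>n. Z n \<omega> \<ge> 2 ^ n"
  using AE_\<xi>
proof eventually_elim
  case (elim \<omega>)
  have "Z n \<omega> \<ge> 2 ^ n" for n
  proof (induction n)
    case (Suc n)
    have "2 ^ Suc n \<le> Z n \<omega> * 2" using Suc by simp
    also have "\<dots> = (\<Sum>i<Z n \<omega>. 2)" by simp
    also have "\<dots> \<le> (\<Sum>i<Z n \<omega>. \<xi> n i \<omega>)" using elim by (intro sum_mono) simp
    also have "\<dots> = Z (Suc n) \<omega>" by simp
    finally show ?case .
  qed simp
  then show ?case by simp
qed

lemma AE_Z_pos: "AE \<omega> in M. \<forall>n. Z n \<omega> > 0"
  using AE_Z_ge
proof eventually_elim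
  case (elim \<omega>)
  show ?case using elim by (metis less_le_trans zero_less_numeral zero_less_power)
qed

text \<open>The Markov property: \<open>Z n\<close> is a function of the rows before
  \<open>n\<close>, and these are independent of row \<open>n\<close>.\<close>

lemma nn_integral_step:
  fixes h :: "nat \<Rightarrow> nat \<Rightarrow> ennreal"
  shows "(\<integral>\<^sup>+\<omega>. h (Z n \<omega>) (Z (Suc n) \<omega>) \<partial>M) =
     (\<integral>\<^sup>+\<omega>. (\<lambda>k. \<integral>\<^sup>+\<omega>'. h k (\<Sum>i<k. \<xi> n i \<omega>') \<partial>M) (Z n \<omega>) \<partial>M)"
proof -
  define A where "A = {..<n} \<times> (UNIV :: nat set)"
  define B where "B = {n} \<times> (UNIV :: nat set)"
  \<comment> \<open>Independence is stated for real-valued variables. \<open>\<zeta>\<close>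
    recovers the integer offspring numbers from the coordinates, so that \<open>gw_Z\<close> can be
    evaluated on a restricted vector.\<close>
  define \<zeta> where "\<zeta> j i f = nat \<lfloor>f (j, i) :: real\<rfloor>" for j i :: nat and f
  let ?PA = "PiM A (\<lambda>_. borel :: real measure)" and ?PB = "PiM B (\<lambda>_. borel :: real measure)"
  let ?Y = "\<lambda>j \<omega>. (case j of (n, i) \<Rightarrow> \<lambda>\<omega>. real (\<xi> n i \<omega>)) \<omega>"
  define g where "g = (\<lambda>(f, f'). h (gw_Z \<zeta> n f) (\<Sum>i<gw_Z \<zeta> n f. \<zeta> n i f'))"
  have \<zeta>A: "\<zeta> j i \<in> measurable ?PA (count_space UNIV)" if "j < n" for j i
    unfolding \<zeta>_def using that by (intro measurable_compose[OF measurable_component_singleton]) (auto simp: A_def)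
  have \<zeta>B [measurable]: "\<zeta> n i \<in> measurable ?PB (count_space UNIV)" for i
    unfolding \<zeta>_def by (intro measurable_compose[OF measurable_component_singleton]) (auto simp: B_def)
  have [measurable]: "gw_Z \<zeta> n \<in> measurable ?PA (count_space UNIV)"
    by (intro measurable_gw_Z \<zeta>A)
  have [measurable]: "(\<lambda>x. \<Sum>i<gw_Z \<zeta> n (fst x). \<zeta> n i (snd x)) \<in> measurable (?PA \<Otimes>\<^sub>M ?PB) (count_space UNIV)"
    by (rule measurable_compose_countable[where g="\<lambda>x. gw_Z \<zeta> n (fst x)"]) measurable
  have "(\<lambda>x. h (gw_Z \<zeta> n (fst x)) (\<Sum>i<gw_Z \<zeta> n (fst x). \<zeta> n i (snd x))) \<in> borel_measurable (?PA \<Otimes>\<^sub>M ?PB)"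
    by measurable
  then have g: "g \<in> borel_measurable (?PA \<Otimes>\<^sub>M ?PB)"
    by (simp add: g_def case_prod_beta')
  have ZA: "gw_Z \<zeta> n (restrict (\<lambda>i. ?Y i \<omega>) A) = Z n \<omega>" for \<omega>
    by (rule gw_Z_cong) (simp add: \<zeta>_def A_def)
  have ZB: "\<zeta> n i (restrict (\<lambda>i. ?Y i \<omega>) B) = \<xi> n i \<omega>" for i \<omega>
    by (simp add: \<zeta>_def B_def)
  have "A \<inter> B = {}" by (auto simp: A_def B_def)
  from indep_vars_restrict_nn_integral[OF \<xi>_indep this g]
  show ?thesis by (simp only: g_def prod.case ZA ZB gw_Z.simps)
qed

lemma Z_nn_mean: "(\<integral>\<^sup>+\<omega>. ennreal (Z n \<omega>) \<partial>M) = ennreal (m ^ n)"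
proof (induction n)
  case (Suc n)
  have *: "(\<integral>\<^sup>+\<omega>'. ennreal (real (\<Sum>i<k. \<xi> n i \<omega>')) \<partial>M) = ennreal m * ennreal k" for k
  proof -
    have "(\<integral>\<^sup>+\<omega>'. ennreal (real (\<Sum>i<k. \<xi> n i \<omega>')) \<partial>M) = (\<integral>\<^sup>+\<omega>'. (\<Sum>i<k. ennreal (\<xi> n i \<omega>')) \<partial>M)"
      by (simp add: sum_ennreal)
    also have "\<dots> = (\<Sum>i<k. \<integral>\<^sup>+\<omega>'. ennreal (\<xi> n i \<omega>') \<partial>M)"
      by (rule nn_integral_sum) simp
    also have "\<dots> = (\<Sum>i<k. \<integral>\<^sup>+k. ennreal (real k) \<partial>measure_pmf p)"
      by (simp add: \<xi>_nn_integral[of "\<lambda>k. ennreal (real k)"])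
    also have "(\<integral>\<^sup>+k. ennreal (real k) \<partial>measure_pmf p) = ennreal m"
      unfolding gw_mean_def using mean_fin by (rule nn_integral_eq_integral) simp
    finally show ?thesis by (simp add: mult.commute ennreal_of_nat_eq_real_of_nat)
  qed
  have "(\<integral>\<^sup>+\<omega>. ennreal (Z (Suc n) \<omega>) \<partial>M) = (\<integral>\<^sup>+\<omega>. ennreal m * ennreal (Z n \<omega>) \<partial>M)"
    using nn_integral_step[of "\<lambda>_ j. ennreal (real j)" n] unfolding * by simp
  also have "\<dots> = ennreal m * ennreal (m ^ n)"
    using Suc by (subst nn_integral_cmult) auto
  finally show ?case using m_pos by (simp add: ennreal_mult')
qed (simp add: emeasure_space_1)

lemma Z_integrable: "integrable M (\<lambda>\<omega>. real (Z n \<omega>))"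
  and Z_mean: "expectation (\<lambda>\<omega>. real (Z n \<omega>)) = m ^ n"
proof -
  show "integrable M (\<lambda>\<omega>. real (Z n \<omega>))"
    by (rule integrableI_bounded) (simp_all add: Z_nn_mean)
  show "expectation (\<lambda>\<omega>. real (Z n \<omega>)) = m ^ n"
    using Z_nn_mean[of n] m_pos by (intro integral_eq_nn_integral[THEN trans]) auto
qed

definition tail_mean :: "real \<Rightarrow> real" where
  "tail_mean c = measure_pmf.expectation p (\<lambda>k. if real k > c then real k else 0)"

lemma tail_mean_nonneg: "tail_mean c \<ge> 0"
  unfolding tail_mean_def by (rule Bochner_Integration.integral_nonneg) auto

text \<open>Split the offspring numbers at the level \<open>c\<close>. The truncated part is controlled by its variance
  and \<open>\<bar>u\<bar> \<le> (t + u\<^sup>2 / t) / 2\<close>, which keeps the bound linear in \<open>k\<close>.\<close>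

lemma row_deviation:
  assumes "t > 0" "c > 0"
  shows "integrable M (\<lambda>\<omega>. \<bar>real (\<Sum>i<k. \<xi> n i \<omega>) - m * k\<bar>)"
    and "expectation (\<lambda>\<omega>. \<bar>real (\<Sum>i<k. \<xi> n i \<omega>) - m * k\<bar>) \<le> t / 2 + (c * m / (2 * t) + 2 * tail_mean c) * k"
proof -
  define u where "u k = (if real k \<le> c then real k else 0)" for k :: nat
  define v where "v k = (if real k > c then real k else 0)" for k :: nat
  define mu where "mu = measure_pmf.expectation p u"
  have int_u: "integrable (measure_pmf p) u" and int_v: "integrable (measure_pmf p) v"
    unfolding u_def v_def by (auto intro!: Bochner_Integration.integrable_bound[OF mean_fin])
  have int_u2: "integrable (measure_pmf p) (\<lambda>k. (u k)\<^sup>2)"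
    using assms by (intro measure_pmf.integrable_const_bound[where B="c\<^sup>2"]) (auto simp: u_def power_mono)
  have m_split: "m = mu + tail_mean c"
  proof -
    have "m = measure_pmf.expectation p (\<lambda>k. u k + v k)"
      unfolding gw_mean_def by (rule arg_cong[where f="integral\<^sup>L _"]) (auto simp: u_def v_def)
    also have "\<dots> = mu + tail_mean c"
      using int_u int_v by (subst Bochner_Integration.integral_add) (auto simp: mu_def tail_mean_def v_def[abs_def])
    finally show ?thesis .
  qed
  have eu2: "measure_pmf.expectation p (\<lambda>k. (u k)\<^sup>2) \<le> c * m"
  proof -
    have "measure_pmf.expectation p (\<lambda>k. (u k)\<^sup>2) \<le> measure_pmf.expectation p (\<lambda>k. c * real k)"
      using assms mean_fin int_u2 by (intro integral_mono) (auto simp: u_def power2_eq_square intro!: mult_right_mono)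
    then show ?thesis by (simp add: gw_mean_def)
  qed
  define U where "U i \<omega> = u (\<xi> n i \<omega>) - mu" for i \<omega>
  have U_meas [measurable]: "U i \<in> borel_measurable M" for i unfolding U_def by measurable
  have U: "integrable M (U i)" "expectation (U i) = 0" "integrable M (\<lambda>\<omega>. (U i \<omega>)\<^sup>2)"
      "expectation (\<lambda>\<omega>. (U i \<omega>)\<^sup>2) \<le> c * m" for i
  proof -
    have i1: "integrable M (\<lambda>\<omega>. u (\<xi> n i \<omega>))" "integrable M (\<lambda>\<omega>. (u (\<xi> n i \<omega>))\<^sup>2)"
      using \<xi>_integrable[of u] \<xi>_integrable[of "\<lambda>k. (u k)\<^sup>2"] int_u int_u2 by auto
    have e1: "expectation (\<lambda>\<omega>. u (\<xi> n i \<omega>)) = mu" "expectation (\<lambda>\<omega>. (u (\<xi> n i \<omega>))\<^sup>2) \<le> c * m"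
      using \<xi>_integral[of u] \<xi>_integral[of "\<lambda>k. (u k)\<^sup>2"] eu2 by (auto simp: mu_def)
    show "integrable M (U i)" "expectation (U i) = 0"
      unfolding U_def using i1 e1 by (auto simp: prob_space)
    have eq: "(\<lambda>\<omega>. (U i \<omega>)\<^sup>2) = (\<lambda>\<omega>. (u (\<xi> n i \<omega>))\<^sup>2 - 2 * mu * u (\<xi> n i \<omega>) + mu\<^sup>2)"
      by (auto simp: U_def power2_eq_square algebra_simps)
    show "integrable M (\<lambda>\<omega>. (U i \<omega>)\<^sup>2)" unfolding eq using i1 by auto
    have "expectation (\<lambda>\<omega>. (U i \<omega>)\<^sup>2) = expectation (\<lambda>\<omega>. (u (\<xi> n i \<omega>))\<^sup>2) - mu\<^sup>2"
      unfolding eq using i1 e1 by (simp add: prob_space power2_eq_square)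
    also have "\<dots> \<le> c * m" using e1(2) zero_le_power2[of mu] by linarith
    finally show "expectation (\<lambda>\<omega>. (U i \<omega>)\<^sup>2) \<le> c * m" .
  qed
  have indU: "indep_vars (\<lambda>_. borel) U {..<k}"
  proof -
    have "indep_vars (\<lambda>_. borel) (\<lambda>i \<omega>. (\<lambda>x. (if x \<le> c then x else 0) - mu) (real (\<xi> n i \<omega>))) {..<k}"
      by (rule indep_vars_compose2[OF indep_vars_subset[OF \<xi>_row_indep]]) auto
    then show ?thesis by (simp add: U_def[abs_def] u_def)
  qed
  have sq: "integrable M (\<lambda>\<omega>. (\<Sum>i<k. U i \<omega>)\<^sup>2)" "expectation (\<lambda>\<omega>. (\<Sum>i<k. U i \<omega>)\<^sup>2) \<le> k * (c * m)"
  proof -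
    have *: "integrable M (\<lambda>\<omega>. (\<Sum>i<k. U i \<omega>)\<^sup>2) \<and>
         expectation (\<lambda>\<omega>. (\<Sum>i<k. U i \<omega>)\<^sup>2) = (\<Sum>i<k. expectation (\<lambda>\<omega>. (U i \<omega>)\<^sup>2))"
      using U by (intro indep_vars_sum_square indU) auto
    then show "integrable M (\<lambda>\<omega>. (\<Sum>i<k. U i \<omega>)\<^sup>2)" by simp
    have "(\<Sum>i<k. expectation (\<lambda>\<omega>. (U i \<omega>)\<^sup>2)) \<le> (\<Sum>i<k. c * m)"
      by (intro sum_mono U)
    with * show "expectation (\<lambda>\<omega>. (\<Sum>i<k. U i \<omega>)\<^sup>2) \<le> k * (c * m)" by simp
  qed
  have v: "integrable M (\<lambda>\<omega>. v (\<xi> n i \<omega>))" "expectation (\<lambda>\<omega>. v (\<xi> n i \<omega>)) = tail_mean c" for i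
    using \<xi>_integrable[of v n i] int_v \<xi>_integral[of v n i] by (auto simp: tail_mean_def v_def[abs_def])
  let ?bd = "\<lambda>\<omega>. t / 2 + (\<Sum>i<k. U i \<omega>)\<^sup>2 / (2 * t) + (\<Sum>i<k. v (\<xi> n i \<omega>) + tail_mean c)"
  have pw: "\<bar>real (\<Sum>i<k. \<xi> n i \<omega>) - m * k\<bar> \<le> ?bd \<omega>" for \<omega>
  proof -
    have "real (\<Sum>i<k. \<xi> n i \<omega>) - m * k = (\<Sum>i<k. real (\<xi> n i \<omega>) - m)"
      by (simp add: sum_subtractf)
    also have "\<dots> = (\<Sum>i<k. U i \<omega> + (v (\<xi> n i \<omega>) - tail_mean c))"
      by (intro sum.cong refl) (auto simp: U_def u_def v_def m_split)
    also have "\<dots> = (\<Sum>i<k. U i \<omega>) + (\<Sum>i<k. v (\<xi> n i \<omega>) - tail_mean c)" by (rule sum.distrib)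
    also have "\<bar>\<dots>\<bar> \<le> \<bar>\<Sum>i<k. U i \<omega>\<bar> + (\<Sum>i<k. \<bar>v (\<xi> n i \<omega>) - tail_mean c\<bar>)"
      by (rule order_trans[OF abs_triangle_ineq]) (intro add_left_mono sum_abs)
    also have "(\<Sum>i<k. \<bar>v (\<xi> n i \<omega>) - tail_mean c\<bar>) \<le> (\<Sum>i<k. v (\<xi> n i \<omega>) + tail_mean c)"
      using tail_mean_nonneg[of c] by (intro sum_mono) (auto simp: v_def)
    also have "\<bar>\<Sum>i<k. U i \<omega>\<bar> \<le> t / 2 + (\<Sum>i<k. U i \<omega>)\<^sup>2 / (2 * t)"
    proof -
      have "0 \<le> (\<bar>\<Sum>i<k. U i \<omega>\<bar> - t)\<^sup>2" by simp
      also have "\<dots> = (\<Sum>i<k. U i \<omega>)\<^sup>2 + t\<^sup>2 - 2 * t * \<bar>\<Sum>i<k. U i \<omega>\<bar>"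
        by (simp add: power2_diff)
      finally have "2 * t * \<bar>\<Sum>i<k. U i \<omega>\<bar> \<le> (\<Sum>i<k. U i \<omega>)\<^sup>2 + t\<^sup>2" by simp
      then show ?thesis using assms by (simp add: field_simps power2_eq_square)
    qed
    finally show ?thesis by simp
  qed
  have int_bd: "integrable M ?bd" using sq(1) v(1) by auto
  show int: "integrable M (\<lambda>\<omega>. \<bar>real (\<Sum>i<k. \<xi> n i \<omega>) - m * k\<bar>)"
  proof (rule Bochner_Integration.integrable_bound[OF int_bd])
    have "norm \<bar>real (\<Sum>i<k. \<xi> n i \<omega>) - m * k\<bar> \<le> norm (?bd \<omega>)" for \<omega>
      using order_trans[OF pw[of \<omega>] abs_ge_self[of "?bd \<omega>"]] by simp
    then show "AE \<omega> in M. norm \<bar>real (\<Sum>i<k. \<xi> n i \<omega>) - m * k\<bar> \<le> norm (?bd \<omega>)" by blast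
  qed measurable
  have "expectation (\<lambda>\<omega>. \<bar>real (\<Sum>i<k. \<xi> n i \<omega>) - m * k\<bar>) \<le> expectation ?bd"
    by (intro integral_mono int int_bd pw)
  also have "\<dots> = t / 2 + expectation (\<lambda>\<omega>. (\<Sum>i<k. U i \<omega>)\<^sup>2) / (2 * t) + 2 * tail_mean c * k"
    using sq(1) v by (simp add: prob_space Bochner_Integration.integral_add)
  also have "\<dots> \<le> t / 2 + k * (c * m) / (2 * t) + 2 * tail_mean c * k"
    using sq(2) assms by (intro add_mono divide_right_mono) auto
  finally show "expectation (\<lambda>\<omega>. \<bar>real (\<Sum>i<k. \<xi> n i \<omega>) - m * k\<bar>) \<le> t / 2 + (c * m / (2 * t) + 2 * tail_mean c) * k"
    by (simp add: algebra_simps)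
qed

text \<open>The bound of \<open>row_deviation\<close> is affine in the generation size. Averaging it
  over \<open>Z n\<close> therefore takes only the mean \<open>m ^ n\<close> and no second moment,
  which might be infinite.\<close>

lemma step_deviation:
  assumes "t > 0" "c > 0"
  shows "(\<integral>\<^sup>+\<omega>. ennreal \<bar>real (Z (Suc n) \<omega>) - m * real (Z n \<omega>)\<bar> \<partial>M) \<le>
      ennreal (t / 2 + (c * m / (2 * t) + 2 * tail_mean c) * m ^ n)"
proof -
  let ?C = "c * m / (2 * t) + 2 * tail_mean c"
  have C: "?C \<ge> 0" using assms m_pos tail_mean_nonneg by simp
  have "(\<integral>\<^sup>+\<omega>. ennreal \<bar>real (Z (Suc n) \<omega>) - m * real (Z n \<omega>)\<bar> \<partial>M) =
     (\<integral>\<^sup>+\<omega>. (\<lambda>k. \<integral>\<^sup>+\<omega>'. ennreal \<bar>real (\<Sum>i<k. \<xi> n i \<omega>') - m * real k\<bar> \<partial>M) (Z n \<omega>) \<partial>M)"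
    using nn_integral_step[of "\<lambda>k j. ennreal \<bar>real j - m * real k\<bar>" n] by simp
  also have "\<dots> \<le> (\<integral>\<^sup>+\<omega>. ennreal (t / 2 + ?C * real (Z n \<omega>)) \<partial>M)"
  proof (intro nn_integral_mono)
    fix \<omega>
    have "(\<integral>\<^sup>+\<omega>'. ennreal \<bar>real (\<Sum>i<k. \<xi> n i \<omega>') - m * real k\<bar> \<partial>M) \<le> ennreal (t / 2 + ?C * real k)" for k
      using row_deviation[OF assms, of n k] by (subst nn_integral_eq_integral) (auto intro!: ennreal_leI)
    then show "(\<lambda>k. \<integral>\<^sup>+\<omega>'. ennreal \<bar>real (\<Sum>i<k. \<xi> n i \<omega>') - m * real k\<bar> \<partial>M) (Z n \<omega>) \<le> ennreal (t / 2 + ?C * real (Z n \<omega>))"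
      by simp
  qed
  also have "\<dots> = ennreal (expectation (\<lambda>\<omega>. t / 2 + ?C * real (Z n \<omega>)))"
    using Z_integrable[of n] C assms by (intro nn_integral_eq_integral) auto
  also have "expectation (\<lambda>\<omega>. t / 2 + ?C * real (Z n \<omega>)) = t / 2 + ?C * m ^ n"
    using Z_integrable[of n] by (simp add: prob_space Z_mean)
  finally show ?thesis .
qed

end

section \<open>Convergence of \<open>Wn\<close> in mean and nondegeneracy of
  \<open>W\<close>\<close>

context galton_watson
begin

definition Wn :: "nat \<Rightarrow> 'a \<Rightarrow> real" where
  "Wn n \<omega> = real (Z n \<omega>) / m ^ n"

definition incr :: "nat \<Rightarrow> 'a \<Rightarrow> real" where
  "incr n \<omega> = \<bar>Wn (Suc n) \<omega> - Wn n \<omega>\<bar>"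

abbreviation W :: "'a \<Rightarrow> real" where "W \<equiv> gw_W \<xi> m"

lemma Wn_meas [measurable]: "Wn n \<in> borel_measurable M"
  unfolding Wn_def by measurable

lemma incr_meas [measurable]: "incr n \<in> borel_measurable M"
  unfolding incr_def by measurable

lemma W_eq: "W \<omega> = lim (\<lambda>n. Wn n \<omega>)"
  by (simp add: gw_W_def Wn_def)

lemma W_meas [measurable]: "W \<in> borel_measurable M"
  unfolding W_eq[abs_def] by measurable

lemma Wn_nonneg: "Wn n \<omega> \<ge> 0"
  using m_pos by (simp add: Wn_def)

text \<open>Exchange sum and expectation: an offspring number \<open>k\<close> exceeds
  \<open>m powr (n / 2)\<close> for at most \<open>1 + 2 * ln k / ln m\<close> indices
  \<open>n\<close>. The sum is thus dominated by the mean of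
  \<open>k + 2 / ln m * (k * ln k)\<close>, which is finite by \<open>LlogL\<close>.\<close>

lemma tail_mean_summable: "summable (\<lambda>n. tail_mean (m powr (real n / 2)))"
proof (rule summableI_nonneg_bounded)
  let ?c = "\<lambda>n. m powr (real n / 2)"
  have lnm: "ln m > 0" using mean_gt1 by simp
  have int: "integrable (measure_pmf p) (\<lambda>k. if real k > c then real k else 0)" for c
    by (auto intro!: Bochner_Integration.integrable_bound[OF mean_fin])
  fix N
  have "(\<Sum>n<N. tail_mean (?c n)) = measure_pmf.expectation p (\<lambda>k. \<Sum>n<N. if real k > ?c n then real k else 0)"
    unfolding tail_mean_def using int by (subst Bochner_Integration.integral_sum) auto
  also have "\<dots> \<le> measure_pmf.expectation p (\<lambda>k. real k + 2 / ln m * (real k * ln (real k)))"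
  proof (rule integral_mono)
    fix k :: nat
    show "(\<Sum>n<N. if real k > ?c n then real k else 0) \<le> real k + 2 / ln m * (real k * ln (real k))"
    proof (cases "k = 0")
      case False
      define x where "x = 2 * ln (real k) / ln m"
      have x: "x \<ge> 0" using lnm False by (simp add: x_def)
      have "{n. n < N \<and> real k > ?c n} \<subseteq> {..nat \<lfloor>x\<rfloor>}"
      proof
        fix n assume "n \<in> {n. n < N \<and> real k > ?c n}"
        then have "ln (?c n) < ln (real k)" using False m_pos by (subst ln_less_cancel_iff) auto
        then have "real n < x" using lnm m_pos by (simp add: ln_powr x_def field_simps)
        then show "n \<in> {..nat \<lfloor>x\<rfloor>}" by (simp add: le_nat_floor)
      qed
      then have "card {n. n < N \<and> real k > ?c n} \<le> card {..nat \<lfloor>x\<rfloor>}" by (intro card_mono) auto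
      then have "real (card {n. n < N \<and> real k > ?c n}) \<le> 1 + x" using x by simp linarith
      then have "real (card {n. n < N \<and> real k > ?c n}) * real k \<le> (1 + x) * real k" by (intro mult_right_mono) auto
      also have "(1 + x) * real k = real k + 2 / ln m * (real k * ln (real k))"
        by (simp add: x_def algebra_simps)
      also have "real (card {n. n < N \<and> real k > ?c n}) * real k = (\<Sum>n\<in>{n. n < N \<and> real k > ?c n}. real k)" by simp
      also have "\<dots> = (\<Sum>n<N. if real k > ?c n then real k else 0)"
        by (subst sum.inter_filter[symmetric]) (auto intro!: sum.cong)
      finally show ?thesis .
    qed simp
  qed (use int mean_fin LlogL in auto)
  finally show "(\<Sum>n<N. tail_mean (?c n)) \<le> measure_pmf.expectation p (\<lambda>k. real k + 2 / ln m * (real k * ln (real k)))" .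
qed (rule tail_mean_nonneg)

text \<open>Comes from \<open>step_deviation\<close> with \<open>c = m powr (n / 2)\<close> and \<open>t = m powr (3 n / 4)\<close>. Truncating this far below
  \<open>m ^ n\<close> costs nothing under the \<open>L log L\<close> condition and makes the increments absolutely summable
  in \<open>L\<^sup>1\<close>, so that no martingale convergence theorem is needed.\<close>

definition incr_bound :: "nat \<Rightarrow> real" where
  "incr_bound n = (1 / (2 * m) + 1 / 2) * (m powr (- 1 / 4)) ^ n + 2 / m * tail_mean (m powr (real n / 2))"

lemma incr_bound_summable: "summable incr_bound"
proof -
  have "m powr (- 1 / 4) < m powr 0" using mean_gt1 by (intro powr_less_mono) auto
  then have "m powr (- 1 / 4) < 1" using m_pos by simp
  then show ?thesis
    unfolding incr_bound_def[abs_def] by (intro summable_add summable_mult tail_mean_summable summable_geometric) auto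
qed

lemma incr_bound_nonneg: "incr_bound n \<ge> 0"
  using m_pos tail_mean_nonneg by (simp add: incr_bound_def)

lemma incr_integrable: "integrable M (incr n)"
  and incr_mean: "expectation (incr n) \<le> incr_bound n"
proof -
  show int: "integrable M (incr n)"
    unfolding incr_def Wn_def using Z_integrable by (intro integrable_abs Bochner_Integration.integrable_diff integrable_divide) blast+
  define c where "c = m powr (real n / 2)"
  define t where "t = m powr (3 * real n / 4)"
  have ct: "c > 0" "t > 0" using m_pos by (auto simp: c_def t_def)
  let ?B = "t / 2 + (c * m / (2 * t) + 2 * tail_mean c) * m ^ n"
  have B: "?B \<ge> 0" using ct m_pos tail_mean_nonneg[of c] by (intro add_nonneg_nonneg mult_nonneg_nonneg) auto
  have incr_eq: "incr n \<omega> = \<bar>real (Z (Suc n) \<omega>) - m * real (Z n \<omega>)\<bar> / m ^ Suc n" for \<omega>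
  proof -
    have "real (Z (Suc n) \<omega>) / m ^ Suc n - real (Z n \<omega>) / m ^ n = (real (Z (Suc n) \<omega>) - m * real (Z n \<omega>)) / m ^ Suc n"
      using m_pos by (simp add: field_simps)
    then show ?thesis using m_pos unfolding incr_def Wn_def by (simp only: abs_divide) simp
  qed
  have int': "integrable M (\<lambda>\<omega>. \<bar>real (Z (Suc n) \<omega>) - m * real (Z n \<omega>)\<bar>)"
    using Z_integrable by (intro integrable_abs Bochner_Integration.integrable_diff integrable_mult_right) blast+
  have "ennreal (expectation (\<lambda>\<omega>. \<bar>real (Z (Suc n) \<omega>) - m * real (Z n \<omega>)\<bar>)) \<le> ennreal ?B"
    using step_deviation[OF ct(2,1), of n] by (subst (asm) nn_integral_eq_integral[OF int']) auto
  then have "expectation (\<lambda>\<omega>. \<bar>real (Z (Suc n) \<omega>) - m * real (Z n \<omega>)\<bar>) \<le> ?B"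
    using B by (simp add: ennreal_le_iff)
  then have "expectation (incr n) \<le> ?B / m ^ Suc n"
    unfolding incr_eq using m_pos by (simp add: divide_right_mono)
  also have "\<dots> = incr_bound n"
  proof -
    \<comment> \<open>The truncation scales are balanced: \<open>t = q * m ^ n\<close> and
      \<open>c = q * t\<close>. So \<open>t\<close> and \<open>(c / t) * m ^ n\<close> are both of
      order \<open>q * m ^ n\<close>, and division by \<open>m ^ Suc n\<close> leaves a geometric
      sequence.\<close>
    define q where "q = (m powr (- 1 / 4)) ^ n"
    have q: "q = m powr (- real n / 4)" using m_pos by (simp add: q_def powr_power)
    have mn: "m ^ n = m powr real n" using m_pos by (simp add: powr_realpow)
    have t: "t = q * m ^ n" unfolding t_def q mn powr_add[symmetric] by (simp add: field_simps)
    have c: "c = q * t" unfolding t_def q c_def powr_add[symmetric] by (simp add: field_simps)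
    have "?B = (1 / (2 * m) + 1 / 2) * q * m ^ Suc n + 2 / m * tail_mean c * m ^ Suc n"
    proof -
      have eq: "c * m / (2 * t) = q * m / 2" using c ct by simp
      have "?B = t / 2 + (q * m / 2 + 2 * tail_mean c) * m ^ n" by (simp only: eq)
      then show ?thesis unfolding t using m_pos by (simp add: field_simps)
    qed
    then show ?thesis using m_pos by (simp add: incr_bound_def q_def c_def add_divide_distrib)
  qed
  finally show "expectation (incr n) \<le> incr_bound n" .
qed

lemma incr_AE_summable: "AE \<omega> in M. summable (\<lambda>n. incr n \<omega>)"
proof -
  have "(\<integral>\<^sup>+\<omega>. (\<Sum>n. ennreal (incr n \<omega>)) \<partial>M) = (\<Sum>n. \<integral>\<^sup>+\<omega>. ennreal (incr n \<omega>) \<partial>M)"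
    by (rule nn_integral_suminf) simp
  also have "\<dots> \<le> (\<Sum>n. ennreal (incr_bound n))"
    using incr_integrable incr_mean
    by (intro suminf_le summableI) (auto simp: nn_integral_eq_integral incr_def[abs_def] intro!: ennreal_leI)
  also have "\<dots> = ennreal (suminf incr_bound)"
    using incr_bound_nonneg incr_bound_summable by (rule suminf_ennreal2)
  finally have "(\<integral>\<^sup>+\<omega>. (\<Sum>n. ennreal (incr n \<omega>)) \<partial>M) \<noteq> \<infinity>"
    by (metis ennreal_neq_top infinity_ennreal_def top.extremum_uniqueI)
  then have "AE \<omega> in M. (\<Sum>n. ennreal (incr n \<omega>)) \<noteq> \<infinity>"
    by (intro nn_integral_PInf_AE) auto
  then show ?thesis
    by eventually_elim (auto intro!: summable_suminf_not_top simp: incr_def)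
qed

lemma Wn_telescope: "Wn n \<omega> = 1 + (\<Sum>i<n. Wn (Suc i) \<omega> - Wn i \<omega>)"
  by (subst sum_lessThan_telescope) (simp add: Wn_def)

lemma Wn_AE_tendsto: "AE \<omega> in M. (\<lambda>n. Wn n \<omega>) \<longlonglongrightarrow> W \<omega>"
  using incr_AE_summable
proof eventually_elim
  case (elim \<omega>)
  then have "summable (\<lambda>n. Wn (Suc n) \<omega> - Wn n \<omega>)"
    unfolding incr_def by (rule summable_rabs_cancel)
  then have "(\<lambda>n. 1 + (\<Sum>i<n. Wn (Suc i) \<omega> - Wn i \<omega>)) \<longlonglongrightarrow> 1 + (\<Sum>n. Wn (Suc n) \<omega> - Wn n \<omega>)"
    by (intro tendsto_intros summable_LIMSEQ)
  then have "convergent (\<lambda>n. Wn n \<omega>)"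
    unfolding Wn_telescope[symmetric] by (rule convergentI)
  then show ?case by (simp add: W_eq convergent_LIMSEQ_iff)
qed

lemma W_AE_nonneg: "AE \<omega> in M. W \<omega> \<ge> 0"
  using Wn_AE_tendsto
  by eventually_elim (auto intro: LIMSEQ_le_const Wn_nonneg)

text \<open>The sum of the increments is integrable and dominates every \<open>Wn n\<close>, so the
  mean 1 survives in the limit. This is the point of the \<open>L log L\<close> condition: it
  excludes that \<open>W\<close> vanishes almost surely.\<close>

lemma W_mean: "expectation W = 1"
proof -
  have sum: "summable (\<lambda>n. expectation (incr n))"
    by (rule summable_comparison_test'[OF incr_bound_summable, of 0])
       (use incr_mean in \<open>auto simp: incr_def[abs_def]\<close>)
  have "integrable M (\<lambda>\<omega>. \<Sum>n. incr n \<omega>)"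
  proof (rule integrable_suminf)
    show "AE \<omega> in M. summable (\<lambda>n. norm (incr n \<omega>))" using incr_AE_summable by (simp add: incr_def)
    show "summable (\<lambda>n. expectation (\<lambda>\<omega>. norm (incr n \<omega>)))" using sum by (simp add: incr_def[abs_def])
  qed (rule incr_integrable)
  then have w: "integrable M (\<lambda>\<omega>. 1 + (\<Sum>n. incr n \<omega>))" by simp
  have "(\<lambda>n. expectation (Wn n)) \<longlonglongrightarrow> expectation W"
  proof (rule integral_dominated_convergence[OF _ _ w Wn_AE_tendsto])
    fix n
    show "AE \<omega> in M. norm (Wn n \<omega>) \<le> 1 + (\<Sum>n. incr n \<omega>)"
      using incr_AE_summable
    proof eventually_elim
      case (elim \<omega>)
      have "norm (Wn n \<omega>) = Wn n \<omega>" using Wn_nonneg by simp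
      also have "\<dots> \<le> 1 + (\<Sum>i<n. incr i \<omega>)"
        by (subst Wn_telescope) (auto intro!: sum_mono simp: incr_def)
      also have "(\<Sum>i<n. incr i \<omega>) \<le> (\<Sum>n. incr n \<omega>)"
        by (intro sum_le_suminf elim) (auto simp: incr_def)
      finally show ?case by simp
    qed
  qed auto
  moreover have "expectation (Wn n) = 1" for n
    unfolding Wn_def using m_pos by (simp add: Z_mean)
  ultimately show ?thesis by (simp add: LIMSEQ_const_iff)
qed

section \<open>Laplace transforms uniformly in the generation\<close>

definition lap :: "nat \<Rightarrow> real \<Rightarrow> real" where
  "lap n v = expectation (\<lambda>\<omega>. exp (- v * Wn n \<omega>))"

definition lap_lim :: "real \<Rightarrow> real" where
  "lap_lim v = expectation (\<lambda>\<omega>. exp (- v * W \<omega>))"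

lemma lap_integrable: "v \<ge> 0 \<Longrightarrow> integrable M (\<lambda>\<omega>. exp (- v * Wn n \<omega>))"
  by (rule integrable_const_bound[where B=1]) (auto simp: Wn_nonneg)

lemma lap_lim_integrable: "v \<ge> 0 \<Longrightarrow> integrable M (\<lambda>\<omega>. exp (- v * W \<omega>))"
  using W_AE_nonneg by (intro integrable_const_bound[where B=1]) auto

lemma lap_tendsto:
  assumes "v \<ge> 0"
  shows "(\<lambda>n. lap n v) \<longlonglongrightarrow> lap_lim v"
  unfolding lap_def lap_lim_def
proof (rule integral_dominated_convergence[where w="\<lambda>_. 1"])
  show "AE \<omega> in M. (\<lambda>n. exp (- v * Wn n \<omega>)) \<longlonglongrightarrow> exp (- v * W \<omega>)"
    using Wn_AE_tendsto by eventually_elim (intro tendsto_intros)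
qed (use assms Wn_nonneg in auto)

lemma lap_nonneg: "lap n v \<ge> 0"
  unfolding lap_def by simp

lemma lap_antimono: "0 \<le> v \<Longrightarrow> v \<le> v' \<Longrightarrow> lap n v' \<le> lap n v"
  unfolding lap_def by (intro integral_mono lap_integrable) (auto simp: Wn_nonneg mult_right_mono)

lemma lap_le_1: "0 \<le> v \<Longrightarrow> lap n v \<le> 1"
  using lap_antimono[of 0 v n] by (simp add: lap_def prob_space)

lemma lap_1_less: "lap n 1 < 1"
proof -
  have "lap n 1 \<le> expectation (\<lambda>\<omega>. exp (- (1 / m ^ n)))"
    unfolding lap_def
  proof (rule integral_mono_AE)
    show "AE \<omega> in M. exp (- 1 * Wn n \<omega>) \<le> exp (- (1 / m ^ n))"
      using AE_Z_pos
    proof eventually_elim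
      case (elim \<omega>)
      then have "1 \<le> real (Z n \<omega>)" by (simp add: Suc_leI)
      then show ?case using m_pos by (simp add: Wn_def divide_right_mono)
    qed
  qed (use lap_integrable[of 1 n] in simp_all)
  also have "\<dots> = exp (- (1 / m ^ n))" by (simp add: prob_space)
  also have "\<dots> < 1" using m_pos by simp
  finally show ?thesis .
qed

lemma lap_lim_1_less: "lap_lim 1 < 1"
proof (rule ccontr)
  assume "\<not> lap_lim 1 < 1"
  moreover have int: "integrable M (\<lambda>\<omega>. 1 - exp (- 1 * W \<omega>))"
    using lap_lim_integrable[of 1] by auto
  moreover have e: "expectation (\<lambda>\<omega>. 1 - exp (- 1 * W \<omega>)) = 1 - lap_lim 1"
    unfolding lap_lim_def using lap_lim_integrable[of 1] by (subst Bochner_Integration.integral_diff) (auto simp: prob_space)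
  moreover have nn: "AE \<omega> in M. 0 \<le> 1 - exp (- 1 * W \<omega>)"
    using W_AE_nonneg by eventually_elim simp
  moreover have "expectation (\<lambda>\<omega>. 1 - exp (- 1 * W \<omega>)) \<ge> 0"
    by (rule integral_nonneg_AE[OF nn])
  ultimately have "expectation (\<lambda>\<omega>. 1 - exp (- 1 * W \<omega>)) = 0" by linarith
  then have "AE \<omega> in M. 1 - exp (- 1 * W \<omega>) = 0"
    using integral_nonneg_eq_0_iff_AE[OF int nn] by simp
  then have "AE \<omega> in M. W \<omega> = 0" by eventually_elim simp
  then have "expectation W = expectation (\<lambda>_. 0)" by (intro integral_cong_AE) auto
  then show False using W_mean by simp
qed

text \<open>Large \<open>n\<close> are covered by convergence to \<open>lap_lim 1 < 1\<close>. Each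
  of the finitely many others is below 1 because \<open>Z n >= 1\<close> almost surely. Including
  \<open>L\<close> in the maximum also keeps \<open>\<rho>\<close> positive, as its logarithm is
  taken later.\<close>

lemma lap_1_uniform: "\<exists>\<rho>. 0 < \<rho> \<and> \<rho> < 1 \<and> (\<forall>n. lap n 1 \<le> \<rho>)"
proof -
  define L where "L = (1 + lap_lim 1) / 2"
  have L: "lap_lim 1 < L" "L < 1" using lap_lim_1_less by (auto simp: L_def)
  have "\<forall>\<^sub>F n in sequentially. lap n 1 < L"
    using order_tendstoD(2)[OF lap_tendsto[of 1] L(1)] by simp
  then obtain N where N: "\<And>n. n \<ge> N \<Longrightarrow> lap n 1 < L" by (auto simp: eventually_sequentially)
  define \<rho> where "\<rho> = Max (insert L ((\<lambda>n. lap n 1) ` {..<N}))"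
  have "lap n 1 \<le> \<rho>" for n
  proof (cases "n < N")
    case True then show ?thesis unfolding \<rho>_def by (intro Max_ge) auto
  next
    case False
    then have "lap n 1 \<le> L" using N[of n] by simp
    also have "L \<le> \<rho>" unfolding \<rho>_def by (intro Max_ge) auto
    finally show ?thesis .
  qed
  moreover have "\<rho> < 1" unfolding \<rho>_def using L lap_1_less by (subst Max_less_iff) auto
  moreover have "0 < \<rho>"
  proof -
    have "lap_lim 1 \<ge> 0" by (simp add: lap_lim_def)
    then have "0 < L" by (simp add: L_def)
    also have "L \<le> \<rho>" unfolding \<rho>_def by (intro Max_ge) auto
    finally show ?thesis .
  qed
  ultimately show ?thesis by blast
qed

definition gf :: "real \<Rightarrow> real" where
  "gf s = measure_pmf.expectation p (\<lambda>k. s ^ k)"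

definition Zgf :: "nat \<Rightarrow> real \<Rightarrow> real" where
  "Zgf n s = expectation (\<lambda>\<omega>. s ^ Z n \<omega>)"

lemma gf_integrable: "0 \<le> (s::real) \<Longrightarrow> s \<le> 1 \<Longrightarrow> integrable (measure_pmf p) (\<lambda>k. s ^ k)"
  by (intro measure_pmf.integrable_const_bound[where B=1]) (auto simp: power_le_one)

lemma gf_nonneg: "0 \<le> s \<Longrightarrow> gf s \<ge> 0"
  unfolding gf_def by (rule Bochner_Integration.integral_nonneg) auto

lemma gf_le_1:
  assumes "0 \<le> s" "s \<le> 1"
  shows "gf s \<le> 1"
proof -
  have "gf s \<le> measure_pmf.expectation p (\<lambda>k. 1)"
    unfolding gf_def using assms by (intro integral_mono gf_integrable) (auto simp: power_le_one)
  then show ?thesis by simp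
qed

lemma gf_le_power:
  assumes "0 \<le> s" "s \<le> 1"
  shows "gf s \<le> s ^ gw_mu p"
proof -
  have "gf s \<le> measure_pmf.expectation p (\<lambda>k. s ^ gw_mu p)"
    unfolding gf_def
  proof (rule integral_mono_AE)
    show "AE k in measure_pmf p. s ^ k \<le> s ^ gw_mu p"
    proof (rule AE_pmfI)
      fix k assume "k \<in> set_pmf p"
      then have "gw_mu p \<le> k" unfolding gw_mu_def by (intro Least_le) (simp add: pmf_positive)
      then show "s ^ k \<le> s ^ gw_mu p" using assms by (intro power_decreasing)
    qed
  qed (use assms gf_integrable in auto)
  then show ?thesis by simp
qed

lemma Zgf_Suc:
  assumes "0 \<le> s" "s \<le> 1"
  shows "Zgf (Suc n) s = Zgf n (gf s)"
proof -
  have inner: "(\<integral>\<^sup>+\<omega>'. ennreal (s ^ (\<Sum>i<k. \<xi> n i \<omega>')) \<partial>M) = ennreal (gf s ^ k)" for k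
  proof -
    have ind: "indep_vars (\<lambda>_. borel) (\<lambda>i \<omega>. (\<lambda>x. s ^ nat \<lfloor>x\<rfloor>) (real (\<xi> n i \<omega>))) {..<k}"
      by (rule indep_vars_compose2[OF indep_vars_subset[OF \<xi>_row_indep]]) auto
    then have ind: "indep_vars (\<lambda>_. borel) (\<lambda>i \<omega>. s ^ \<xi> n i \<omega>) {..<k}" by simp
    have int: "integrable M (\<lambda>\<omega>. s ^ \<xi> n i \<omega>)" for i
      using \<xi>_integrable[of "\<lambda>k. s ^ k"] gf_integrable[OF assms] by simp
    have "(\<integral>\<^sup>+\<omega>'. ennreal (s ^ (\<Sum>i<k. \<xi> n i \<omega>')) \<partial>M) = (\<integral>\<^sup>+\<omega>'. ennreal (\<Prod>i<k. s ^ \<xi> n i \<omega>') \<partial>M)"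
      by (simp add: power_sum)
    also have "\<dots> = ennreal (expectation (\<lambda>\<omega>'. \<Prod>i<k. s ^ \<xi> n i \<omega>'))"
      using indep_vars_integrable[OF _ ind] int assms by (intro nn_integral_eq_integral) (auto intro!: prod_nonneg)
    also have "expectation (\<lambda>\<omega>'. \<Prod>i<k. s ^ \<xi> n i \<omega>') = (\<Prod>i<k. expectation (\<lambda>\<omega>'. s ^ \<xi> n i \<omega>'))"
      using indep_vars_lebesgue_integral[OF _ ind] int by simp
    also have "\<dots> = gf s ^ k"
      by (simp add: \<xi>_integral[of "\<lambda>k. s ^ k"] gf_def)
    finally show ?thesis .
  qed
  have eq: "(\<integral>\<^sup>+\<omega>. ennreal (s ^ Z (Suc n) \<omega>) \<partial>M) = (\<integral>\<^sup>+\<omega>. ennreal (gf s ^ Z n \<omega>) \<partial>M)"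
    using nn_integral_step[of "\<lambda>_ j. ennreal (s ^ j)" n] unfolding inner .
  have "Zgf (Suc n) s = enn2real (\<integral>\<^sup>+\<omega>. ennreal (s ^ Z (Suc n) \<omega>) \<partial>M)"
    unfolding Zgf_def using assms by (intro integral_eq_nn_integral) auto
  also have "\<dots> = Zgf n (gf s)"
    unfolding Zgf_def eq using gf_nonneg assms by (intro integral_eq_nn_integral[symmetric]) auto
  finally show ?thesis .
qed

text \<open>Conditioning on generation \<open>n\<close> puts \<open>gf\<close> inside. As iterates
  of one function commute, it can be moved outside, which corresponds to a decomposition at the
  first generation. Only in this form does \<open>gf s <= s ^ gw_mu p\<close> act on the value of a
  Laplace transform.\<close>

lemma Zgf_Suc':
  assumes "0 \<le> s" "s \<le> 1"
  shows "Zgf (Suc n) s = gf (Zgf n s)"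
  using assms
proof (induction n arbitrary: s)
  case 0
  then show ?case by (simp add: Zgf_Suc) (simp add: Zgf_def prob_space)
next
  case (Suc n)
  then show ?case using gf_nonneg gf_le_1 by (metis Zgf_Suc)
qed

lemma lap_eq_Zgf: "lap n v = Zgf n (exp (- v / m ^ n))"
  unfolding lap_def Zgf_def Wn_def by (simp add: exp_of_nat_mult[symmetric] mult.commute)

lemma lap_Suc_le:
  assumes "v \<ge> 0"
  shows "lap (Suc n) (m * v) \<le> lap n v ^ gw_mu p"
proof -
  have "lap (Suc n) (m * v) = Zgf (Suc n) (exp (- v / m ^ n))"
    using m_pos by (simp add: lap_eq_Zgf)
  also have "\<dots> = gf (lap n v)"
    using assms m_pos by (subst Zgf_Suc') (auto simp: lap_eq_Zgf)
  also have "\<dots> \<le> lap n v ^ gw_mu p"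
    using assms by (intro gf_le_power lap_nonneg lap_le_1)
  finally show ?thesis .
qed

lemma mu_pos: "pmf p (gw_mu p) > 0"
proof -
  obtain k where "k \<in> set_pmf p" using set_pmf_not_empty[of p] by blast
  then have "pmf p k > 0" by (rule pmf_positive)
  then show ?thesis unfolding gw_mu_def by (rule LeastI)
qed

lemma mu_ge_2: "gw_mu p \<ge> 2"
  using mu_pos by (intro support_ge_2) (simp add: set_pmf_iff)

lemma mu_le_mean: "real (gw_mu p) \<le> m"
proof -
  have "measure_pmf.expectation p (\<lambda>k. real (gw_mu p)) \<le> measure_pmf.expectation p real"
  proof (rule integral_mono_AE)
    show "AE k in measure_pmf p. real (gw_mu p) \<le> real k"
      by (rule AE_pmfI) (auto simp: gw_mu_def pmf_positive intro!: Least_le)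
  qed (use mean_fin in auto)
  then show ?thesis by (simp add: gw_mean_def)
qed

abbreviation \<beta> :: real where "\<beta> \<equiv> gw_beta p"

lemma beta_pos: "\<beta> > 0" and beta_le_1: "\<beta> \<le> 1" and m_powr_beta: "m powr \<beta> = gw_mu p"
proof -
  have lnm: "ln m > 0" using mean_gt1 by simp
  have mu: "real (gw_mu p) \<ge> 2" using mu_ge_2 by simp
  show "\<beta> > 0" unfolding gw_beta_def using lnm mu by simp
  show "\<beta> \<le> 1" unfolding gw_beta_def using lnm mu mu_le_mean by (simp add: field_simps)
  show "m powr \<beta> = gw_mu p" unfolding gw_beta_def powr_def using lnm mu m_pos by simp
qed

lemma lap_stretched_exp: "\<exists>c>0. \<forall>n. \<forall>v\<ge>1. lap n v \<le> exp (- c * v powr \<beta>)"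
proof -
  obtain \<rho> where \<rho>: "0 < \<rho>" "\<rho> < 1" "\<And>n. lap n 1 \<le> \<rho>" using lap_1_uniform by blast
  \<comment> \<open>The 1 is for generation 0, where the transform is \<open>exp (- v)\<close> and
    \<open>v powr \<beta> <= v\<close>. The other term is for \<open>1 <= v < m\<close>: there
    \<open>v powr \<beta>\<close> is at most \<open>m powr \<beta> = gw_mu p\<close>, so
    \<open>lap <= \<rho> <= exp (- c * gw_mu p)\<close> suffices.\<close>
  define c where "c = min 1 (- ln \<rho> / gw_mu p)"
  have mu: "real (gw_mu p) > 0" using mu_ge_2 by simp
  have c: "c > 0" "c \<le> 1" using \<rho> mu by (auto simp: c_def divide_neg_pos)
  have c\<rho>: "\<rho> \<le> exp (- c * gw_mu p)"
  proof -
    have "c \<le> - ln \<rho> / gw_mu p" by (simp add: c_def)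
    then have "ln \<rho> \<le> - c * gw_mu p" using mu by (simp add: field_simps)
    then show ?thesis using \<rho> by (metis exp_le_cancel_iff exp_ln)
  qed
  have "lap n v \<le> exp (- c * v powr \<beta>)" if "v \<ge> 1" for n v
    using that
  proof (induction n arbitrary: v)
    case 0
    have "c * v powr \<beta> \<le> 1 * v powr 1"
      using c beta_le_1 0 by (intro mult_mono powr_mono) auto
    then show ?case using 0 by (simp add: lap_def Wn_def prob_space)
  next
    case (Suc n)
    show ?case
    proof (cases "v \<ge> m")
      case True
      have v: "v / m \<ge> 1" using True m_pos by simp
      have "lap (Suc n) v = lap (Suc n) (m * (v / m))" using m_pos by simp
      also have "\<dots> \<le> lap n (v / m) ^ gw_mu p" using v by (intro lap_Suc_le) auto
      also have "\<dots> \<le> exp (- c * (v / m) powr \<beta>) ^ gw_mu p"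
        by (intro power_mono Suc.IH v lap_nonneg)
      also have "\<dots> = exp (gw_mu p * (- c * (v / m) powr \<beta>))"
        by (rule exp_of_nat_mult[symmetric])
      \<comment> \<open>By \<open>m powr \<beta> = gw_mu p\<close> the constant \<open>c\<close>
        passes through the induction step without loss; this is what makes \<open>\<beta>\<close>
        the right exponent.\<close>
      also have "gw_mu p * (- c * (v / m) powr \<beta>) = - c * v powr \<beta>"
        using Suc.prems m_pos mu by (simp add: powr_divide m_powr_beta)
      finally show ?thesis .
    next
      case False
      have "lap (Suc n) v \<le> lap (Suc n) 1" using Suc.prems by (intro lap_antimono) auto
      also have "\<dots> \<le> exp (- c * gw_mu p)" using \<rho>(3) c\<rho> by (rule order_trans)
      also have "\<dots> \<le> exp (- c * v powr \<beta>)"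
        using c False Suc.prems beta_pos by (auto simp flip: m_powr_beta intro!: powr_mono2)
      finally show ?thesis .
    qed
  qed
  then show ?thesis using c by blast
qed

end

section \<open>Negative moments and small generations\<close>

text \<open>The substitution \<open>t = y * v\<close> in the Gamma integral. In the form of a
  nonnegative integral it can be averaged over \<open>y\<close> by Tonelli.\<close>

lemma nn_integral_Gamma_scaled:
  fixes y q :: real
  assumes "y > 0" "q > 0"
  shows "(\<integral>\<^sup>+v. ennreal (indicator {0<..} v * (exp (- v * y) * v powr (q - 1))) \<partial>lborel) = ennreal (Gamma q * y powr (- q))"
proof -
  let ?I = "\<integral>\<^sup>+v. ennreal (indicator {0<..} v * (exp (- v * y) * v powr (q - 1))) \<partial>lborel"
  have "ennreal (Gamma q) = (\<integral>\<^sup>+t. ennreal (indicator {0..} t * t powr (q - 1) / exp t) \<partial>lborel)"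
    by (rule Gamma_conv_nn_integral_real) fact
  also have "\<dots> = ennreal \<bar>y\<bar> * (\<integral>\<^sup>+v. ennreal (indicator {0..} (0 + y * v) * (0 + y * v) powr (q - 1) / exp (0 + y * v)) \<partial>lborel)"
    using assms by (intro nn_integral_real_affine) auto
  also have "(\<integral>\<^sup>+v. ennreal (indicator {0..} (0 + y * v) * (0 + y * v) powr (q - 1) / exp (0 + y * v)) \<partial>lborel) =
     (\<integral>\<^sup>+v. ennreal (y powr (q - 1)) * ennreal (indicator {0<..} v * (exp (- v * y) * v powr (q - 1))) \<partial>lborel)"
  proof (rule nn_integral_cong)
    fix v :: real
    have "indicator {0..} (0 + y * v) * (0 + y * v) powr (q - 1) / exp (0 + y * v) =
        y powr (q - 1) * (indicator {0<..} v * (exp (- v * y) * v powr (q - 1)))"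
    proof (cases "v > 0")
      case True
      then show ?thesis using assms by (simp add: powr_mult exp_minus field_simps indicator_def)
    next
      case False
      \<comment> \<open>At \<open>v = 0\<close> the two indicators differ, but
        \<open>0 powr (q - 1)\<close> is 0, so both sides vanish.\<close>
      then show ?thesis using assms by (cases "v = 0") (auto simp: indicator_def zero_le_mult_iff)
    qed
    then show "ennreal (indicator {0..} (0 + y * v) * (0 + y * v) powr (q - 1) / exp (0 + y * v)) =
        ennreal (y powr (q - 1)) * ennreal (indicator {0<..} v * (exp (- v * y) * v powr (q - 1)))"
      by (simp only: ennreal_mult'[symmetric] powr_ge_zero)
  qed
  also have "\<dots> = ennreal (y powr (q - 1)) * ?I"
    by (rule nn_integral_cmult) simp
  finally have "ennreal (Gamma q) = ennreal \<bar>y\<bar> * (ennreal (y powr (q - 1)) * ?I)" .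
  also have "\<dots> = ennreal (y powr q) * ?I"
  proof -
    have "y * y powr (q - 1) = y powr q" using assms by (simp add: powr_diff)
    then have "ennreal y * ennreal (y powr (q - 1)) = ennreal (y powr q)"
      using assms by (simp add: ennreal_mult'[symmetric])
    then show ?thesis using assms by (simp add: mult.assoc[symmetric])
  qed
  finally have eq: "ennreal (Gamma q) = ennreal (y powr q) * ?I" .
  have "ennreal (Gamma q * y powr (- q)) = ennreal (y powr (- q)) * ennreal (Gamma q)"
    using assms by (simp add: ennreal_mult' mult.commute)
  also have "\<dots> = (ennreal (y powr (- q)) * ennreal (y powr q)) * ?I"
    unfolding eq by (simp only: mult.assoc)
  also have "ennreal (y powr (- q)) * ennreal (y powr q) = 1"
    using assms by (simp add: ennreal_mult'[symmetric] powr_add[symmetric])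
  finally show ?thesis by simp
qed

section \<open>Negative moments of \<open>Wn\<close> as Laplace integrals\<close>

context galton_watson
begin

lemma lap_meas [measurable]: "lap n \<in> borel_measurable borel"
  unfolding lap_def[abs_def] by measurable

lemma lap_lim_meas [measurable]: "lap_lim \<in> borel_measurable borel"
  unfolding lap_lim_def[abs_def] by measurable

text \<open>A crude bound, with two uses: integrability for each fixed \<open>n\<close>, and the
  trivial estimate on small generations, where a power of \<open>m ^ n\<close> is outweighed by
  their probability.\<close>

lemma Wn_powr_bound:
  assumes "q \<ge> 0" "Z n \<omega> > 0"
  shows "Wn n \<omega> powr (- q) \<le> m powr (q * n)"
proof -
  have "Wn n \<omega> \<ge> 1 / m ^ n" unfolding Wn_def using assms m_pos by (intro divide_right_mono) auto
  then have "Wn n \<omega> powr (- q) \<le> (1 / m ^ n) powr (- q)"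
    using assms m_pos by (intro powr_mono2') auto
  also have "\<dots> = m powr (q * n)"
    using m_pos by (simp add: powr_realpow[symmetric] powr_divide powr_minus powr_powr mult.commute)
  finally show ?thesis .
qed

lemma Wn_powr_integrable:
  assumes "q \<ge> 0"
  shows "integrable M (\<lambda>\<omega>. Wn n \<omega> powr (- q))"
proof (rule integrable_const_bound)
  show "AE \<omega> in M. norm (Wn n \<omega> powr (- q)) \<le> m powr (q * n)"
    using AE_Z_pos by eventually_elim (use Wn_powr_bound[OF assms] in auto)
qed measurable

lemma Wn_moment_eq:
  assumes "q > 0"
  shows "Gamma q * expectation (\<lambda>\<omega>. Wn n \<omega> powr (- q)) = (LBINT v:{0<..}. lap n v * v powr (q - 1))"
proof -
  interpret L: pair_sigma_finite M lborel ..
  let ?f = "\<lambda>\<omega> v. ennreal (indicator {0<..} v * (exp (- v * Wn n \<omega>) * v powr (q - 1)))"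
  have G: "Gamma q > 0" using assms by (rule Gamma_real_pos)
  have "ennreal (Gamma q * expectation (\<lambda>\<omega>. Wn n \<omega> powr (- q))) = ennreal (expectation (\<lambda>\<omega>. Gamma q * Wn n \<omega> powr (- q)))"
    by simp
  also have "\<dots> = (\<integral>\<^sup>+\<omega>. ennreal (Gamma q * Wn n \<omega> powr (- q)) \<partial>M)"
    using Wn_powr_integrable[of q n] assms G by (intro nn_integral_eq_integral[symmetric]) auto
  also have "\<dots> = (\<integral>\<^sup>+\<omega>. \<integral>\<^sup>+v. ?f \<omega> v \<partial>lborel \<partial>M)"
  proof (rule nn_integral_cong_AE)
    show "AE \<omega> in M. ennreal (Gamma q * Wn n \<omega> powr (- q)) = (\<integral>\<^sup>+v. ?f \<omega> v \<partial>lborel)"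
      using AE_Z_pos
    proof eventually_elim
      case (elim \<omega>)
      then have "Wn n \<omega> > 0" using m_pos by (simp add: Wn_def)
      from nn_integral_Gamma_scaled[OF this assms] show ?case by simp
    qed
  qed
  also have "\<dots> = (\<integral>\<^sup>+v. \<integral>\<^sup>+\<omega>. ?f \<omega> v \<partial>M \<partial>lborel)"
    by (rule L.Fubini'[symmetric]) measurable
  also have "\<dots> = (\<integral>\<^sup>+v. ennreal (indicator {0<..} v * (lap n v * v powr (q - 1))) \<partial>lborel)"
  proof (rule nn_integral_cong)
    fix v :: real
    show "(\<integral>\<^sup>+\<omega>. ?f \<omega> v \<partial>M) = ennreal (indicator {0<..} v * (lap n v * v powr (q - 1)))"
    proof (cases "v > 0")
      case True
      then have "(\<integral>\<^sup>+\<omega>. ?f \<omega> v \<partial>M) = (\<integral>\<^sup>+\<omega>. ennreal (exp (- v * Wn n \<omega>) * v powr (q - 1)) \<partial>M)" by simp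
      also have "\<dots> = ennreal (expectation (\<lambda>\<omega>. exp (- v * Wn n \<omega>) * v powr (q - 1)))"
        using True lap_integrable[of v n] by (intro nn_integral_eq_integral) auto
      also have "\<dots> = ennreal (lap n v * v powr (q - 1))" by (simp add: lap_def)
      finally show ?thesis using True by simp
    qed simp
  qed
  finally have eq: "ennreal (Gamma q * expectation (\<lambda>\<omega>. Wn n \<omega> powr (- q))) =
      (\<integral>\<^sup>+v. ennreal (indicator {0<..} v * (lap n v * v powr (q - 1))) \<partial>lborel)" .
  have "Gamma q * expectation (\<lambda>\<omega>. Wn n \<omega> powr (- q)) \<ge> 0"
    using G by (intro mult_nonneg_nonneg Bochner_Integration.integral_nonneg) auto
  then have "Gamma q * expectation (\<lambda>\<omega>. Wn n \<omega> powr (- q)) =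
      enn2real (ennreal (Gamma q * expectation (\<lambda>\<omega>. Wn n \<omega> powr (- q))))"
    by (rule enn2real_ennreal[symmetric])
  also have "\<dots> = enn2real (\<integral>\<^sup>+v. ennreal (indicator {0<..} v * (lap n v * v powr (q - 1))) \<partial>lborel)"
    by (simp only: eq)
  also have "\<dots> = (\<integral>v. indicator {0<..} v * (lap n v * v powr (q - 1)) \<partial>lborel)"
    using lap_nonneg by (intro integral_eq_nn_integral[symmetric]) auto
  finally show ?thesis by (simp add: set_lebesgue_integral_def)
qed

text \<open>For large \<open>v\<close> the stretched exponential beats every power. For bounded
  \<open>v\<close> the transform is at most 1, and \<open>q >= 1\<close> keeps
  \<open>v powr (q - 1)\<close> bounded down to 0. The function \<open>inverse (1 + v^2)\<close> is
  merely a convenient integrable majorant.\<close>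

lemma lap_dominated:
  assumes "q \<ge> 1"
  shows "\<exists>C. \<forall>n. \<forall>v>0. lap n v * v powr (q - 1) \<le> C * inverse (1 + v\<^sup>2)"
proof -
  obtain c where c: "c > 0" "\<And>n v. v \<ge> 1 \<Longrightarrow> lap n v \<le> exp (- c * v powr \<beta>)"
    using lap_stretched_exp by blast
  define b where "b = \<beta>"
  have b: "b > 0" using beta_pos by (simp add: b_def)
  have "((\<lambda>v::real. exp (- c * v powr b) * v powr (q - 1) * (1 + v\<^sup>2)) \<longlongrightarrow> 0) at_top"
    using c(1) b by real_asymp
  then have "\<forall>\<^sub>F v in at_top. exp (- c * v powr b) * v powr (q - 1) * (1 + v\<^sup>2) < 1"
    by (intro order_tendstoD(2)[where y=0]) auto
  then obtain v0 where v0: "\<And>v. v \<ge> v0 \<Longrightarrow> exp (- c * v powr b) * v powr (q - 1) * (1 + v\<^sup>2) < 1"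
    by (auto simp: eventually_at_top_linorder)
  define v1 where "v1 = max 1 v0"
  define C where "C = v1 powr (q - 1) * (1 + v1\<^sup>2)"
  have C1: "C \<ge> 1"
  proof -
    have "1 * 1 \<le> v1 powr (q - 1) * (1 + v1\<^sup>2)"
      using assms by (intro mult_mono ge_one_powr_ge_zero) (auto simp: v1_def)
    then show ?thesis by (simp add: C_def)
  qed
  have "lap n v * v powr (q - 1) * (1 + v\<^sup>2) \<le> C" if "v > 0" for n v
  proof (cases "v \<le> v1")
    case True
    have "lap n v * v powr (q - 1) * (1 + v\<^sup>2) \<le> 1 * v1 powr (q - 1) * (1 + v1\<^sup>2)"
      using that True assms lap_le_1[of v n] lap_nonneg[of n v]
      by (intro mult_mono powr_mono2 add_mono power_mono) auto
    then show ?thesis by (simp add: C_def)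
  next
    case False
    then have "v \<ge> 1" "v \<ge> v0" by (auto simp: v1_def)
    then have "lap n v * v powr (q - 1) * (1 + v\<^sup>2) \<le> exp (- c * v powr b) * v powr (q - 1) * (1 + v\<^sup>2)"
      using c(2)[of v n] by (intro mult_right_mono) (auto simp: b_def)
    also have "\<dots> \<le> C" using v0[OF \<open>v \<ge> v0\<close>] C1 by linarith
    finally show ?thesis .
  qed
  then have "lap n v * v powr (q - 1) \<le> C * inverse (1 + v\<^sup>2)" if "v > 0" for n v
    using that by (simp add: field_simps add_pos_nonneg)
  then show ?thesis by blast
qed

lemma Wn_moment_tendsto:
  assumes "q \<ge> 1"
  shows "(\<lambda>n. expectation (\<lambda>\<omega>. Wn n \<omega> powr (- q))) \<longlonglongrightarrow>
     1 / Gamma q * (LBINT v:{0<..}. lap_lim v * v powr (q - 1))"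
proof -
  have G: "Gamma q > 0" using assms by (intro Gamma_real_pos) auto
  obtain C where C: "\<And>n v. v > 0 \<Longrightarrow> lap n v * v powr (q - 1) \<le> C * inverse (1 + v\<^sup>2)"
    using lap_dominated[OF assms] by blast
  have int: "integrable lborel (\<lambda>v::real. inverse (1 + v\<^sup>2))"
    using integrable_inverse_1_plus_square by (simp add: set_integrable_def)
  have "(\<lambda>n. LBINT v:{0<..}. lap n v * v powr (q - 1)) \<longlonglongrightarrow> (LBINT v:{0<..}. lap_lim v * v powr (q - 1))"
    unfolding set_lebesgue_integral_def
  proof (rule integral_dominated_convergence[where w="\<lambda>v. \<bar>C\<bar> * inverse (1 + v\<^sup>2)"])
    show "AE v in lborel. (\<lambda>n. indicator {0<..} v *\<^sub>R (lap n v * v powr (q - 1))) \<longlonglongrightarrow> indicator {0<..} v *\<^sub>R (lap_lim v * v powr (q - 1))"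
    proof (intro AE_I2)
      fix v :: real
      show "(\<lambda>n. indicator {0<..} v *\<^sub>R (lap n v * v powr (q - 1))) \<longlonglongrightarrow> indicator {0<..} v *\<^sub>R (lap_lim v * v powr (q - 1))"
        by (cases "v > 0") (auto intro!: tendsto_intros lap_tendsto)
    qed
    show "AE v in lborel. norm (indicator {0<..} v *\<^sub>R (lap n v * v powr (q - 1))) \<le> \<bar>C\<bar> * inverse (1 + v\<^sup>2)" for n
    proof (intro AE_I2)
      fix v :: real
      show "norm (indicator {0<..} v *\<^sub>R (lap n v * v powr (q - 1))) \<le> \<bar>C\<bar> * inverse (1 + v\<^sup>2)"
      proof (cases "v > 0")
        case True
        have "lap n v * v powr (q - 1) \<le> C * inverse (1 + v\<^sup>2)" by (rule C) fact
        also have "\<dots> \<le> \<bar>C\<bar> * inverse (1 + v\<^sup>2)" by (intro mult_right_mono) auto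
        finally show ?thesis using True lap_nonneg[of n v] by simp
      qed simp
    qed
  qed (use int in auto)
  then have "(\<lambda>n. 1 / Gamma q * (LBINT v:{0<..}. lap n v * v powr (q - 1))) \<longlonglongrightarrow>
     1 / Gamma q * (LBINT v:{0<..}. lap_lim v * v powr (q - 1))"
    by (intro tendsto_intros)
  moreover have "1 / Gamma q * (LBINT v:{0<..}. lap n v * v powr (q - 1)) = expectation (\<lambda>\<omega>. Wn n \<omega> powr (- q))" for n
    using Wn_moment_eq[of q n, symmetric] assms less_imp_neq[OF G] by simp
  ultimately show ?thesis by simp
qed

section \<open>Rarity of generations outside the jump regime\<close>

context
  fixes \<epsilon> :: "nat \<Rightarrow> real"
  assumes \<epsilon>_pos: "\<And>n. \<epsilon> n > 0"
    and \<epsilon>_growth: "filterlim (\<lambda>n. \<epsilon> n * m powr (real n / 2) * real n powr (-1 / (2 * \<beta>))) at_top sequentially"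
begin

text \<open>The squared form matches its use: for \<open>y = \<epsilon> n * k\<close> the quotient
  \<open>y^2 / k\<close>, to be compared with \<open>ln k\<close>, is
  \<open>(\<epsilon> n)^2 * k\<close>.\<close>

lemma growth_square: "filterlim (\<lambda>n. (\<epsilon> n)\<^sup>2 * m ^ n / real n powr (1 / \<beta>)) at_top sequentially"
proof (rule filterlim_at_top_mono)
  show "filterlim (\<lambda>n. (\<epsilon> n * m powr (real n / 2) * real n powr (-1 / (2 * \<beta>)))\<^sup>2) at_top sequentially"
    by (rule filterlim_pow_at_top[OF _ \<epsilon>_growth]) simp
  show "\<forall>\<^sub>F n in sequentially. (\<epsilon> n * m powr (real n / 2) * real n powr (-1 / (2 * \<beta>)))\<^sup>2 \<le> (\<epsilon> n)\<^sup>2 * m ^ n / real n powr (1 / \<beta>)"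
    using eventually_gt_at_top[of 0]
  proof eventually_elim
    case (elim n)
    have "(m powr (real n / 2))\<^sup>2 = m ^ n"
      using m_pos by (simp add: power2_eq_square powr_add[symmetric] powr_realpow)
    moreover have "(real n powr (-1 / (2 * \<beta>)))\<^sup>2 = 1 / real n powr (1 / \<beta>)"
    proof -
      have "-1 / (2 * \<beta>) + -1 / (2 * \<beta>) = - (1 / \<beta>)" using beta_pos by (simp add: field_simps)
      then show ?thesis by (simp only: power2_eq_square powr_add[symmetric] powr_minus) (simp add: field_simps)
    qed
    ultimately show ?case by (simp add: power_mult_distrib)
  qed
qed

text \<open>Exponential Markov inequality at \<open>v = (A n) powr (1 / \<beta>)\<close>, for which \<open>v powr \<beta> = A n\<close>.\<close>

lemma small_population:
  fixes L q :: real
  assumes q: "q > 0"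
  shows "(\<lambda>n. m powr (q * n) * prob {\<omega>\<in>space M. (\<epsilon> n)\<^sup>2 * Z n \<omega> < L * n}) \<longlonglongrightarrow> 0"
proof -
  obtain c where c: "c > 0" "\<And>n v. v \<ge> 1 \<Longrightarrow> lap n v \<le> exp (- c * v powr \<beta>)"
    using lap_stretched_exp by blast
  \<comment> \<open>In \<open>c * A = q * ln m + 2\<close> the term \<open>q * ln m\<close> absorbs
    \<open>m powr (q * n)\<close>, one unit absorbs the factor \<open>exp n\<close> lost in the
    Markov bound, and the other leaves \<open>exp (- n)\<close>.\<close>
  define A where "A = (q * ln m + 2) / c"
  have lnm: "ln m > 0" using mean_gt1 by simp
  have A: "A > 0" using c(1) q lnm by (auto simp: A_def intro!: divide_pos_pos add_pos_pos)
  have cA: "c * A = q * ln m + 2" using c(1) by (simp add: A_def)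
  have Markov: "prob {\<omega>\<in>space M. (\<epsilon> n)\<^sup>2 * Z n \<omega> < L * n} \<le> exp (v * (L * n / ((\<epsilon> n)\<^sup>2 * m ^ n))) * lap n v" if v: "v \<ge> 0" for n v
  proof -
    let ?x = "L * n / ((\<epsilon> n)\<^sup>2 * m ^ n)"
    define E where "E = {\<omega>\<in>space M. (\<epsilon> n)\<^sup>2 * Z n \<omega> < L * n}"
    have [measurable]: "E \<in> events" unfolding E_def by measurable
    have "prob E = expectation (indicator E)" by simp
    also have "\<dots> \<le> expectation (\<lambda>\<omega>. exp (v * ?x) * exp (- v * Wn n \<omega>))"
    proof (rule integral_mono)
      show "integrable M (\<lambda>\<omega>. exp (v * ?x) * exp (- v * Wn n \<omega>))" using lap_integrable[OF v] by simp
      fix \<omega>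
      show "indicator E \<omega> \<le> exp (v * ?x) * exp (- v * Wn n \<omega>)"
      proof (cases "\<omega> \<in> E")
        case True
        then have "(\<epsilon> n)\<^sup>2 * Z n \<omega> \<le> L * n" by (simp add: E_def)
        then have "Wn n \<omega> \<le> ?x" using \<epsilon>_pos[of n] m_pos by (simp add: Wn_def field_simps)
        then have "v * Wn n \<omega> \<le> v * ?x" using v by (rule mult_left_mono)
        then have "exp (v * ?x - v * Wn n \<omega>) \<ge> 1" by simp
        moreover have "exp (v * ?x) * exp (- v * Wn n \<omega>) = exp (v * ?x - v * Wn n \<omega>)"
          by (simp add: exp_add[symmetric])
        ultimately show ?thesis using True by simp
      qed simp
    qed (simp add: emeasure_eq_measure)
    also have "\<dots> = exp (v * ?x) * lap n v" by (simp add: lap_def)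
    finally show ?thesis by (simp add: E_def)
  qed
  have "\<forall>\<^sub>F n in sequentially. (\<epsilon> n)\<^sup>2 * m ^ n / real n powr (1 / \<beta>) \<ge> A powr (1 / \<beta>) * L"
    using growth_square by (auto simp: filterlim_at_top)
  moreover have "\<forall>\<^sub>F n in sequentially. A * real n \<ge> 1"
    using A by real_asymp
  ultimately have ev: "\<forall>\<^sub>F n in sequentially. m powr (q * n) * prob {\<omega>\<in>space M. (\<epsilon> n)\<^sup>2 * Z n \<omega> < L * n} \<le> exp (- real n)"
    using eventually_gt_at_top[of 0]
  proof eventually_elim
    case (elim n)
    define v where "v = (A * n) powr (1 / \<beta>)"
    have v1: "v \<ge> 1" unfolding v_def using elim beta_pos by (intro ge_one_powr_ge_zero) auto
    have vb: "v powr \<beta> = A * n" unfolding v_def using elim beta_pos by (simp add: powr_powr)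
    have pos: "(\<epsilon> n)\<^sup>2 * m ^ n > 0" using \<epsilon>_pos[of n] m_pos by simp
    \<comment> \<open>Since \<open>v = A powr (1 / \<beta>) * n powr (1 / \<beta>)\<close>, this is
      the eventual lower bound drawn from \<open>growth_square\<close>. Here the power of
      \<open>n\<close> in the hypothesis on \<open>\<epsilon>\<close> is spent.\<close>
    have "v * L \<le> (\<epsilon> n)\<^sup>2 * m ^ n"
      using elim A by (simp add: v_def powr_mult field_simps)
    then have "v * L * n \<le> (\<epsilon> n)\<^sup>2 * m ^ n * n" by (intro mult_right_mono) auto
    then have vx: "v * (L * n / ((\<epsilon> n)\<^sup>2 * m ^ n)) \<le> n" using pos by (simp add: pos_divide_le_eq mult_ac)
    have "prob {\<omega>\<in>space M. (\<epsilon> n)\<^sup>2 * Z n \<omega> < L * n} \<le> exp (v * (L * n / ((\<epsilon> n)\<^sup>2 * m ^ n))) * lap n v"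
      using v1 by (intro Markov) auto
    also have "\<dots> \<le> exp n * exp (- c * v powr \<beta>)"
      using vx c(2)[OF v1] lap_nonneg[of n v] by (intro mult_mono) auto
    also have "\<dots> = exp (n - c * A * n)" unfolding vb by (simp add: exp_add[symmetric] mult.assoc)
    finally have "m powr (q * n) * prob {\<omega>\<in>space M. (\<epsilon> n)\<^sup>2 * Z n \<omega> < L * n} \<le> m powr (q * n) * exp (n - c * A * n)"
      by (intro mult_left_mono) auto
    also have "\<dots> = exp (q * n * ln m + (n - c * A * n))"
      using m_pos by (simp add: powr_def exp_add)
    also have "q * n * ln m + (n - c * A * n) = - real n" unfolding cA by (simp add: algebra_simps)
    finally show ?case .
  qed
  show ?thesis
  proof (rule tendsto_sandwich[OF _ ev tendsto_const])
    show "(\<lambda>n. exp (- real n)) \<longlonglongrightarrow> 0" by real_asymp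
    show "\<forall>\<^sub>F n in sequentially. 0 \<le> m powr (q * n) * prob {\<omega>\<in>space M. (\<epsilon> n)\<^sup>2 * Z n \<omega> < L * n}" by simp
  qed
qed

text \<open>For \<open>\<epsilon> n > 1\<close> the premise would give \<open>k < N * ln k\<close>,
  impossible for large \<open>k\<close>. Moreover \<open>k <= m ^ n\<close>: since
  \<open>\<beta> <= 1\<close>, the growth condition makes \<open>(\<epsilon> n)^2 * m ^ n\<close>
  exceed any multiple of \<open>n\<close>, and a larger \<open>k\<close> only raises the left side
  of the premise faster than the right one. So \<open>ln k <= n * ln m\<close>, which turns the
  random threshold into the deterministic one of \<open>small_population\<close>. The bound
  \<open>\<epsilon> n <= 1\<close> later allows \<open>\<epsilon> n powr \<theta>\<close> to be
  dropped.\<close>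

lemma bad_generation:
  fixes N :: nat
  assumes "N > 0"
  shows "\<forall>\<^sub>F n in sequentially. \<forall>k\<ge>2 ^ n. (\<epsilon> n)\<^sup>2 * real k < N * ln k \<longrightarrow>
     \<epsilon> n \<le> 1 \<and> (\<epsilon> n)\<^sup>2 * real k < (N * ln m) * n"
proof -
  have lnm: "ln m > 0" using mean_gt1 by simp
  have "\<forall>\<^sub>F x in at_top. N * ln x \<le> x" by real_asymp
  then obtain x0 where x0: "\<And>x. x \<ge> x0 \<Longrightarrow> N * ln x \<le> (x::real)" by (auto simp: eventually_at_top_linorder)
  have "\<forall>\<^sub>F n in sequentially. (2::real) ^ n \<ge> x0" by real_asymp
  moreover have "\<forall>\<^sub>F n in sequentially. (\<epsilon> n)\<^sup>2 * m ^ n / real n powr (1 / \<beta>) \<ge> N * (ln m + 1)"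
    using growth_square by (auto simp: filterlim_at_top)
  ultimately show ?thesis using eventually_gt_at_top[of 0]
  proof eventually_elim
    case (elim n)
    have n1: "real n \<ge> 1" using elim by simp
    have "real n powr 1 \<le> real n powr (1 / \<beta>)"
      using n1 beta_pos beta_le_1 by (intro powr_mono) auto
    then have nb: "real n \<le> real n powr (1 / \<beta>)" using n1 by simp
    have "N * (ln m + 1) * n \<le> N * (ln m + 1) * real n powr (1 / \<beta>)"
      using nb lnm by (intro mult_left_mono) auto
    also have "\<dots> \<le> (\<epsilon> n)\<^sup>2 * m ^ n" using elim by (simp add: field_simps)
    finally have big: "N * (ln m + 1) * n \<le> (\<epsilon> n)\<^sup>2 * m ^ n" .
    show ?case
    proof (intro allI impI)
      fix k :: nat assume k: "k \<ge> 2 ^ n" and bad: "(\<epsilon> n)\<^sup>2 * real k < N * ln k"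
      have "real k \<ge> real (2 ^ n)" using k by (simp only: of_nat_le_iff)
      then have kr: "real k \<ge> 2 ^ n" by simp
      have kx: "N * ln (real k) \<le> real k" by (rule x0[OF order_trans[OF elim(1) kr]])
      have kp: "real k > 0" using kr by (smt (verit) zero_less_power)
      have e1: "\<epsilon> n \<le> 1"
      proof (rule ccontr)
        assume "\<not> \<epsilon> n \<le> 1"
        then have "(\<epsilon> n)\<^sup>2 \<ge> 1" by (simp add: one_le_power)
        then have "(\<epsilon> n)\<^sup>2 * real k \<ge> 1 * real k" by (intro mult_right_mono) auto
        with kx bad show False by linarith
      qed
      have km: "real k \<le> m ^ n"
      proof (rule ccontr)
        assume "\<not> real k \<le> m ^ n"
        \<comment> \<open>With \<open>k = m ^ n * r\<close> one has
          \<open>ln k = n * ln m + ln r <= r * (ln m + 1) * n\<close>. The extra 1 in the threshold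
          \<open>N * (ln m + 1)\<close> pays for \<open>ln r\<close>.\<close>
        define r where "r = real k / m ^ n"
        have r: "r \<ge> 1" using \<open>\<not> real k \<le> m ^ n\<close> m_pos by (simp add: r_def)
        have kr: "real k = m ^ n * r" using m_pos by (simp add: r_def)
        have "ln (real k) = n * ln m + ln r" unfolding kr using m_pos r by (simp add: ln_mult ln_realpow)
        also have "\<dots> \<le> r * (n * ln m) + r * n"
        proof (rule add_mono)
          show "n * ln m \<le> r * (n * ln m)" using r lnm mult_right_mono[of 1 r "n * ln m"] by simp
          have "ln r \<le> r" using ln_le_minus_one[of r] r by simp
          also have "r \<le> r * n" using r n1 mult_left_mono[of 1 "real n" r] by simp
          finally show "ln r \<le> r * n" .
        qed
        also have "\<dots> = r * ((ln m + 1) * n)" by (simp add: algebra_simps)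
        finally have "N * ln (real k) \<le> N * (r * ((ln m + 1) * n))" by (intro mult_left_mono) auto
        also have "\<dots> = r * (N * (ln m + 1) * n)" by simp
        also have "\<dots> \<le> r * ((\<epsilon> n)\<^sup>2 * m ^ n)" using big r by (intro mult_left_mono) auto
        also have "\<dots> = (\<epsilon> n)\<^sup>2 * real k" by (simp add: kr)
        finally show False using bad by simp
      qed
      have "ln (real k) \<le> ln (m ^ n)" using km kp m_pos by (subst ln_le_cancel_iff) auto
      then have "N * ln (real k) \<le> N * (n * ln m)" using m_pos by (intro mult_left_mono) (auto simp: ln_realpow)
      then show "\<epsilon> n \<le> 1 \<and> (\<epsilon> n)\<^sup>2 * real k < (N * ln m) * n" using bad e1 by (simp add: mult_ac)
    qed
  qed
qed

end

end

text \<open>The offspring variables (\<open>Inl\<close>) and the steps of the walk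
  (\<open>Inr\<close>) form two independent blocks, and the first determines \<open>Z n\<close>. So
  the generation size may be frozen at \<open>k\<close> while the walk is integrated out; for
  \<open>k > 0\<close> the event becomes \<open>rw_S X k >= e * k\<close>.\<close>

lemma (in prob_space) prob_gw_R:
  assumes \<xi>_meas [measurable]: "\<And>n i. \<xi> n i \<in> measurable M (count_space UNIV)"
    and X_meas [measurable]: "\<And>k. X k \<in> borel_measurable M"
    and indep: "indep_vars (\<lambda>_. borel) (gw_family \<xi> X) UNIV"
  shows "prob {\<omega> \<in> space M. gw_R \<xi> X n \<omega> \<ge> e \<and> gw_Z \<xi> n \<omega> > 0} =
     expectation (\<lambda>\<omega>. (\<lambda>k. if k > 0 then prob {\<omega>' \<in> space M. rw_S X k \<omega>' \<ge> e * k} else 0) (gw_Z \<xi> n \<omega>))"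
proof -
  define A where "A = range (Inl :: nat \<times> nat \<Rightarrow> (nat \<times> nat) + nat)"
  define B where "B = range (Inr :: nat \<Rightarrow> (nat \<times> nat) + nat)"
  define \<zeta> where "\<zeta> j i f = nat \<lfloor>f (Inl (j, i)) :: real\<rfloor>" for j i :: nat and f :: "(nat \<times> nat) + nat \<Rightarrow> real"
  define Q where "Q k f \<longleftrightarrow> k > 0 \<and> (\<Sum>i<k. f (Inr i)) \<ge> e * real k" for k :: nat and f :: "(nat \<times> nat) + nat \<Rightarrow> real"
  let ?PA = "PiM A (\<lambda>_. borel :: real measure)" and ?PB = "PiM B (\<lambda>_. borel :: real measure)"
  let ?Y = "gw_family \<xi> X"
  define g :: "_ \<Rightarrow> ennreal" where "g = (\<lambda>(f, f'). if Q (gw_Z \<zeta> n f) f' then 1 else 0)"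
  have [measurable]: "gw_Z \<xi> n \<in> measurable M (count_space UNIV)" by (rule measurable_gw_Z) simp
  have \<zeta>A: "\<zeta> j i \<in> measurable ?PA (count_space UNIV)" for j i
    unfolding \<zeta>_def by (intro measurable_compose[OF measurable_component_singleton]) (auto simp: A_def)
  have [measurable]: "gw_Z \<zeta> n \<in> measurable ?PA (count_space UNIV)"
    by (intro measurable_gw_Z \<zeta>A)
  have comp: "(\<lambda>f. f (Inr i)) \<in> borel_measurable ?PB" for i
    by (rule measurable_component_singleton) (simp add: B_def)
  have QB: "Measurable.pred ?PB (Q k)" for k
    unfolding Q_def using comp by measurable
  have "(\<lambda>x. (\<lambda>k x. if Q k (snd x) then 1 else 0 :: ennreal) (gw_Z \<zeta> n (fst x)) x) \<in> borel_measurable (?PA \<Otimes>\<^sub>M ?PB)"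
    by (rule measurable_compose_countable) (use QB in measurable)
  then have g: "g \<in> borel_measurable (?PA \<Otimes>\<^sub>M ?PB)"
    by (simp add: g_def case_prod_beta')
  have ZA: "gw_Z \<zeta> n (restrict (\<lambda>i. ?Y i \<omega>) A) = gw_Z \<xi> n \<omega>" for \<omega>
    by (rule gw_Z_cong) (simp add: \<zeta>_def A_def gw_family_def)
  have ZB: "Q k (restrict (\<lambda>i. ?Y i \<omega>) B) \<longleftrightarrow> k > 0 \<and> rw_S X k \<omega> \<ge> e * k" for k \<omega>
    by (simp add: Q_def B_def rw_S_def gw_family_def)
  have AB: "A \<inter> B = {}" by (auto simp: A_def B_def)
  define E where "E = {\<omega> \<in> space M. gw_R \<xi> X n \<omega> \<ge> e \<and> gw_Z \<xi> n \<omega> > 0}"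
  have E_alt: "E = {\<omega> \<in> space M. gw_Z \<xi> n \<omega> > 0 \<and> rw_S X (gw_Z \<xi> n \<omega>) \<omega> \<ge> e * gw_Z \<xi> n \<omega>}"
    unfolding E_def gw_R_def by (auto simp: field_simps)
  have [measurable]: "(\<lambda>\<omega>. rw_S X (gw_Z \<xi> n \<omega>) \<omega>) \<in> borel_measurable M"
    unfolding rw_S_def by (rule measurable_compose_countable[where g="gw_Z \<xi> n"]) auto
  have [measurable]: "E \<in> events" unfolding E_alt by measurable
  let ?h = "\<lambda>k. if k > 0 then prob {\<omega>' \<in> space M. rw_S X k \<omega>' \<ge> e * k} else 0"
  have "ennreal (prob E) = (\<integral>\<^sup>+\<omega>. indicator E \<omega> \<partial>M)" by (simp add: emeasure_eq_measure)
  also have "\<dots> = (\<integral>\<^sup>+\<omega>. g (restrict (\<lambda>i. ?Y i \<omega>) A, restrict (\<lambda>i. ?Y i \<omega>) B) \<partial>M)"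
    by (intro nn_integral_cong) (auto simp: g_def ZA ZB E_alt indicator_def)
  also have "\<dots> = (\<integral>\<^sup>+\<omega>. \<integral>\<^sup>+\<omega>'. g (restrict (\<lambda>i. ?Y i \<omega>) A, restrict (\<lambda>i. ?Y i \<omega>') B) \<partial>M \<partial>M)"
    by (rule indep_vars_restrict_nn_integral[OF indep AB g])
  also have "\<dots> = (\<integral>\<^sup>+\<omega>. ennreal (?h (gw_Z \<xi> n \<omega>)) \<partial>M)"
  proof (rule nn_integral_cong)
    fix \<omega>
    have *: "(\<integral>\<^sup>+\<omega>'. (if k > 0 \<and> rw_S X k \<omega>' \<ge> e * k then 1 else 0) \<partial>M) = ennreal (?h k)" for k
    proof (cases "k > 0")
      case True
      have "(\<integral>\<^sup>+\<omega>'. (if k > 0 \<and> rw_S X k \<omega>' \<ge> e * k then 1 else 0) \<partial>M) =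
          (\<integral>\<^sup>+\<omega>'. indicator {\<omega>' \<in> space M. rw_S X k \<omega>' \<ge> e * k} \<omega>' \<partial>M)"
        using True by (intro nn_integral_cong) (auto simp: indicator_def)
      also have "\<dots> = ennreal (?h k)"
        using True by (subst nn_integral_indicator) (auto simp: emeasure_eq_measure rw_S_def)
      finally show ?thesis .
    qed simp
    show "(\<integral>\<^sup>+\<omega>'. g (restrict (\<lambda>i. ?Y i \<omega>) A, restrict (\<lambda>i. ?Y i \<omega>') B) \<partial>M) = ennreal (?h (gw_Z \<xi> n \<omega>))"
      unfolding g_def prod.case ZA ZB by (rule *)
  qed
  also have "\<dots> = ennreal (expectation (\<lambda>\<omega>. ?h (gw_Z \<xi> n \<omega>)))"
  proof (intro nn_integral_eq_integral integrable_const_bound[where B=1])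
    show "(\<lambda>\<omega>. ?h (gw_Z \<xi> n \<omega>)) \<in> borel_measurable M"
      by (rule measurable_compose[where f="gw_Z \<xi> n" and N="count_space UNIV"]) auto
  qed auto
  finally have "prob E = expectation (\<lambda>\<omega>. ?h (gw_Z \<xi> n \<omega>))"
    by (subst (asm) ennreal_inj) (auto intro!: Bochner_Integration.integral_nonneg)
  then show ?thesis by (simp add: E_def)
qed

section \<open>Combination of the walk estimate with the negative moments\<close>

theorem theorem4:
  fixes M :: "'a measure" and p :: "nat pmf"
    and \<xi> :: "nat \<Rightarrow> nat \<Rightarrow> 'a \<Rightarrow> nat" and X :: "nat \<Rightarrow> 'a \<Rightarrow> real"
    and a \<theta> :: real and \<epsilon> :: "nat \<Rightarrow> real"
  assumes "prob_space M"
    and \<xi>_meas: "\<And>n i. \<xi> n i \<in> measurable M (count_space UNIV)"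
    and \<xi>_law: "\<And>n i. distr M (count_space UNIV) (\<xi> n i) = measure_pmf p"
    and X_meas: "\<And>k. X k \<in> borel_measurable M"
    and X_iid: "\<And>k. distr M borel (X k) = distr M borel (X 0)"
    and indep: "prob_space.indep_vars M (\<lambda>_. borel) (gw_family \<xi> X) UNIV"
    and mean_fin: "integrable (measure_pmf p) real"
    and mean_gt1: "gw_mean p > 1"
    and LlogL: "integrable (measure_pmf p) (\<lambda>k. real k * ln (real k))"
    and X_int: "integrable M (X 0)" and X_mean: "integral\<^sup>L M (X 0) = 0"
    and X_sq: "integrable M (\<lambda>\<omega>. (X 0 \<omega>)\<^sup>2)"
    and X_var: "integral\<^sup>L M (\<lambda>\<omega>. (X 0 \<omega>)\<^sup>2) > 0"
    and boettcher: "pmf p 0 = 0" "pmf p 1 = 0"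
    and a_pos: "a > 0" and \<theta>_gt: "\<theta> > 2"
    and tail: "(\<lambda>x. measure M {\<omega> \<in> space M. X 0 \<omega> \<ge> x}) \<sim>[at_top] (\<lambda>x. a * x powr (-\<theta>))"
    and \<epsilon>_pos: "\<And>n. \<epsilon> n > 0"
    and \<epsilon>_growth: "filterlim (\<lambda>n. \<epsilon> n * gw_mean p powr (real n / 2)
                        * real n powr (-1 / (2 * gw_beta p))) at_top sequentially"
  shows "(\<lambda>n. \<epsilon> n powr \<theta> * gw_mean p powr ((\<theta> - 1) * real n)
            * measure M {\<omega> \<in> space M. gw_R \<xi> X n \<omega> \<ge> \<epsilon> n \<and> gw_Z \<xi> n \<omega> > 0})
         \<longlonglongrightarrow> a * ((1 / Gamma (\<theta> - 1)) *
              (LBINT v:{0<..}. integral\<^sup>L M (\<lambda>\<omega>. exp (- v * gw_W \<xi> (gw_mean p) \<omega>))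
                                 * v powr (\<theta> - 2)))"
proof -
  interpret prob_space M by fact
  have G_indep: "indep_vars (\<lambda>_. borel) (\<lambda>(n, i) \<omega>. real (\<xi> n i \<omega>)) UNIV"
  proof -
    have "(\<lambda>j. gw_family \<xi> X (Inl j)) = (\<lambda>(n, i) \<omega>. real (\<xi> n i \<omega>))"
      by (auto simp: gw_family_def fun_eq_iff)
    then show ?thesis using indep_vars_reindex[OF indep, of Inl] by simp
  qed
  interpret G: galton_watson M p \<xi>
    by unfold_locales (fact \<xi>_meas \<xi>_law G_indep mean_fin mean_gt1 LlogL boettcher)+
  have X_indep: "indep_vars (\<lambda>_. borel) X UNIV"
  proof -
    have "(\<lambda>j. gw_family \<xi> X (Inr j)) = X" by (auto simp: gw_family_def fun_eq_iff)
    then show ?thesis using indep_vars_reindex[OF indep, of Inr] by simp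
  qed
  interpret C: centered_iid M X
    by unfold_locales (fact X_indep X_iid X_int X_mean X_sq)+
  have V_tail: "((\<lambda>x. C.tailp x * x powr \<theta>) \<longlongrightarrow> a) at_top"
  proof -
    have "(\<lambda>x. C.tailp x * x powr \<theta>) \<sim>[at_top] (\<lambda>x. a * x powr (-\<theta>) * x powr \<theta>)"
      using tail by (intro asymp_equiv_mult) (simp_all add: C.tailp_def[abs_def])
    moreover have "\<forall>\<^sub>F x in at_top. a * x powr (-\<theta>) * x powr \<theta> = a"
      using eventually_gt_at_top[of 0] by eventually_elim (simp add: powr_minus)
    then have "((\<lambda>x. a * x powr (-\<theta>) * x powr \<theta>) \<longlongrightarrow> a) at_top"
      by (rule tendsto_eventually)
    ultimately show ?thesis by (simp add: tendsto_asymp_equiv_cong)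
  qed
  interpret H: heavy_tailed_iid M X a \<theta>
    by unfold_locales (fact a_pos \<theta>_gt V_tail)+
  define q where "q = \<theta> - 1"
  have q: "q > 0" "q \<ge> 1" using \<theta>_gt by (auto simp: q_def)
  define g where "g n k = (if k > 0 then prob {\<omega> \<in> space M. rw_S X k \<omega> \<ge> \<epsilon> n * k} else 0)" for n k
  \<comment> \<open>The normalised conditional probability of the event given \<open>Z n\<close>. It
    is compared pathwise with \<open>a * Wn powr (- q)\<close>, and only then are expectations
    taken.\<close>
  define T where "T n \<omega> = \<epsilon> n powr \<theta> * G.m powr (q * n) * g n (G.Z n \<omega>)" for n \<omega>
  define Mom where "Mom n = expectation (\<lambda>\<omega>. G.Wn n \<omega> powr (- q))" for n
  have g01: "0 \<le> g n k" "g n k \<le> 1" for n k by (auto simp: g_def)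
  have [measurable]: "(\<lambda>\<omega>. g n (G.Z n \<omega>)) \<in> borel_measurable M" for n
    by (rule measurable_compose[where f="G.Z n" and N="count_space UNIV"]) auto
  have T_meas [measurable]: "T n \<in> borel_measurable M" for n unfolding T_def by measurable
  have T_int: "integrable M (T n)" for n
    unfolding T_def by (intro integrable_mult_right integrable_const_bound[where B=1]) (use g01 in auto)
  have goal_eq: "\<epsilon> n powr \<theta> * gw_mean p powr ((\<theta> - 1) * real n)
            * measure M {\<omega> \<in> space M. gw_R \<xi> X n \<omega> \<ge> \<epsilon> n \<and> gw_Z \<xi> n \<omega> > 0} = expectation (T n)" for n
    unfolding T_def g_def by (simp add: prob_gw_R[OF \<xi>_meas X_meas indep] q_def)
  define I where "I = 1 / Gamma q * (LBINT v:{0<..}. G.lap_lim v * v powr (q - 1))"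
  have Mom_lim: "Mom \<longlonglongrightarrow> I"
    unfolding Mom_def I_def by (rule G.Wn_moment_tendsto) fact
  \<comment> \<open>In the jump regime the relative error is at most \<open>\<eta>\<close>. Outside
    it, \<open>T n\<close> and \<open>a * Wn powr (- q)\<close> are bounded by
    \<open>m powr (q * n)\<close> and \<open>a * m powr (q * n)\<close>, whence the factor
    \<open>1 + a\<close>. The level \<open>L\<close> depends on \<open>\<eta>\<close> through
    \<open>N\<close>, which is harmless because \<open>small_population\<close> holds for every
    \<open>L\<close>.\<close>
  have key: "\<exists>L::real. \<forall>\<^sub>F n in sequentially. \<bar>expectation (T n) - a * Mom n\<bar> \<le>
      \<eta> * Mom n + (1 + a) * (G.m powr (q * n) * prob {\<omega>\<in>space M. (\<epsilon> n)\<^sup>2 * G.Z n \<omega> < L * n})" if \<eta>_pos: "\<eta> > 0" for \<eta>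
  proof -
    obtain N :: nat where N: "N > 0" "\<And>k y. k \<ge> N \<Longrightarrow> y > 0 \<Longrightarrow> y\<^sup>2 \<ge> real N * (real k * ln (real k)) \<Longrightarrow>
       \<bar>prob {\<omega>\<in>space M. rw_S X k \<omega> \<ge> y} * y powr \<theta> / k - a\<bar> \<le> \<eta>"
      using H.walk_large_deviation_uniform[OF \<eta>_pos] by blast
    define L where "L = N * ln G.m"
    have "\<forall>\<^sub>F n in sequentially. (2::nat) ^ n \<ge> N"
      using eventually_ge_at_top[of N] by eventually_elim (metis le_trans less_exp less_imp_le_nat)
    moreover have "\<forall>\<^sub>F n in sequentially. \<forall>k\<ge>2 ^ n. (\<epsilon> n)\<^sup>2 * real k < N * ln k \<longrightarrow>
       \<epsilon> n \<le> 1 \<and> (\<epsilon> n)\<^sup>2 * real k < (N * ln G.m) * n"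
      by (rule G.bad_generation[OF \<epsilon>_pos \<epsilon>_growth N(1)])
    ultimately have fin: "\<forall>\<^sub>F n in sequentially. \<bar>expectation (T n) - a * Mom n\<bar> \<le>
      \<eta> * Mom n + (1 + a) * (G.m powr (q * n) * prob {\<omega>\<in>space M. (\<epsilon> n)\<^sup>2 * G.Z n \<omega> < L * n})"
    proof eventually_elim
      case (elim n)
      define E where "E = {\<omega>\<in>space M. (\<epsilon> n)\<^sup>2 * G.Z n \<omega> < L * n}"
      have E_meas [measurable]: "E \<in> events" unfolding E_def by measurable
      have Wint: "integrable M (\<lambda>\<omega>. G.Wn n \<omega> powr (- q))" using q by (intro G.Wn_powr_integrable) auto
      let ?bd = "\<lambda>\<omega>. \<eta> * G.Wn n \<omega> powr (- q) + (1 + a) * (G.m powr (q * n) * indicator E \<omega>)"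
      have bd_int: "integrable M ?bd"
        using Wint by (intro Bochner_Integration.integrable_add integrable_mult_right) (auto simp: emeasure_eq_measure)
      have diff_int: "integrable M (\<lambda>\<omega>. T n \<omega> - a * G.Wn n \<omega> powr (- q))"
        using Wint T_int by (intro Bochner_Integration.integrable_diff integrable_mult_right) auto
      have pw: "AE \<omega> in M. \<bar>T n \<omega> - a * G.Wn n \<omega> powr (- q)\<bar> \<le> ?bd \<omega>"
        using G.AE_Z_ge AE_space
      proof eventually_elim
        case (elim \<omega>)
        define k where "k = G.Z n \<omega>"
        have k: "k \<ge> 2 ^ n" "k \<ge> N" using elim \<open>N \<le> 2 ^ n\<close> by (auto simp: k_def intro: order_trans)
        have kpos: "k > 0" using k N(1) by simp
        define w where "w = G.Wn n \<omega> powr (- q)"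
        have w_eq: "w = real k powr (- q) * G.m powr (q * n)"
          unfolding w_def G.Wn_def k_def[symmetric] using kpos G.m_pos
          by (simp add: powr_divide powr_minus powr_realpow[symmetric] powr_powr field_simps)
        have w0: "w \<ge> 0" by (simp add: w_def)
        have w_le: "w \<le> G.m powr (q * n)"
          unfolding w_def using q kpos by (intro G.Wn_powr_bound) (auto simp: k_def)
        show ?case
        proof (cases "(\<epsilon> n * k)\<^sup>2 \<ge> real N * (real k * ln (real k))")
          case True
          define r where "r = prob {\<omega>\<in>space M. rw_S X k \<omega> \<ge> \<epsilon> n * k} * (\<epsilon> n * k) powr \<theta> / k"
          have r: "\<bar>r - a\<bar> \<le> \<eta>"
            unfolding r_def using k kpos \<epsilon>_pos[of n] True by (intro N(2)) auto
          \<comment> \<open>The choice \<open>q = \<theta> - 1\<close> makes the powers of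
            \<open>k\<close> cancel: the normalisation
            \<open>(\<epsilon> n * k) powr \<theta> / k\<close> of the walk estimate times
            \<open>k powr (- q)\<close> is \<open>\<epsilon> n powr \<theta>\<close>.\<close>
          have "T n \<omega> = r * w"
          proof -
            have "(\<epsilon> n * k) powr \<theta> / k * real k powr (- q) = \<epsilon> n powr \<theta>"
              using kpos \<epsilon>_pos[of n] by (simp add: q_def powr_mult powr_minus powr_diff field_simps)
            moreover have "r * w = prob {\<omega>\<in>space M. rw_S X k \<omega> \<ge> \<epsilon> n * k} *
                ((\<epsilon> n * k) powr \<theta> / k * real k powr (- q)) * G.m powr (q * n)"
              unfolding r_def w_eq by simp
            ultimately show ?thesis using kpos by (simp add: T_def g_def k_def[symmetric])
          qed
          then have "\<bar>T n \<omega> - a * w\<bar> = \<bar>r - a\<bar> * w" using w0 by (simp add: abs_mult left_diff_distrib[symmetric])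
          also have "\<dots> \<le> \<eta> * w" using r w0 by (intro mult_right_mono)
          also have "\<dots> \<le> \<eta> * w + (1 + a) * (G.m powr (q * n) * indicator E \<omega>)"
            using a_pos by simp
          finally show ?thesis by (simp add: w_def)
        next
          case False
          then have "real k * ((\<epsilon> n)\<^sup>2 * real k) < real k * (N * ln (real k))"
            by (simp add: power2_eq_square mult_ac)
          then have "(\<epsilon> n)\<^sup>2 * real k < N * ln (real k)" using kpos by simp
          then have e: "\<epsilon> n \<le> 1" "(\<epsilon> n)\<^sup>2 * real k < L * n"
            using \<open>\<forall>k\<ge>2 ^ n. _ k\<close> k(1) by (auto simp: L_def)
          have "\<omega> \<in> E" using e(2) elim by (simp add: E_def k_def)
          have "\<epsilon> n powr \<theta> \<le> 1"
            using e(1) \<epsilon>_pos[of n] \<theta>_gt by (intro powr_le1) auto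
          then have "T n \<omega> \<le> 1 * G.m powr (q * n) * 1"
            unfolding T_def using g01 by (intro mult_mono) auto
          moreover have "T n \<omega> \<ge> 0" unfolding T_def using g01 by simp
          moreover have "a * w \<le> a * G.m powr (q * n)" "a * w \<ge> 0"
            using w_le w0 a_pos by (auto intro: mult_left_mono)
          ultimately have "\<bar>T n \<omega> - a * w\<bar> \<le> (1 + a) * G.m powr (q * n)"
            by (simp add: algebra_simps)
          moreover have "\<eta> * w \<ge> 0" using w0 \<eta>_pos by simp
          ultimately show ?thesis using \<open>\<omega> \<in> E\<close> by (simp add: w_def[symmetric])
        qed
      qed
      have "\<bar>expectation (T n) - a * Mom n\<bar> = \<bar>expectation (\<lambda>\<omega>. T n \<omega> - a * G.Wn n \<omega> powr (- q))\<bar>"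
        using T_int Wint by (simp add: Mom_def)
      also have "\<dots> \<le> expectation (\<lambda>\<omega>. \<bar>T n \<omega> - a * G.Wn n \<omega> powr (- q)\<bar>)"
        by (rule integral_abs_bound)
      also have "\<dots> \<le> expectation ?bd"
        using diff_int bd_int pw by (intro integral_mono_AE) auto
      also have "\<dots> = \<eta> * Mom n + (1 + a) * (G.m powr (q * n) * prob E)"
        using Wint by (simp add: Mom_def emeasure_eq_measure)
      finally show ?case by (simp add: E_def)
    qed
    show ?thesis by (rule exI[of _ L], rule fin)
  qed
  have "(\<lambda>n. expectation (T n) - a * Mom n) \<longlonglongrightarrow> 0"
  proof (rule tendstoI)
    fix e :: real assume e: "e > 0"
    define B where "B = \<bar>I\<bar> + 1"
    have B: "B > 0" by (simp add: B_def)
    have evB: "\<forall>\<^sub>F n in sequentially. Mom n < B"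
      by (rule order_tendstoD(2)[OF Mom_lim]) (simp add: B_def)
    define \<eta> where "\<eta> = e / (2 * B)"
    have \<eta>: "\<eta> > 0" using e B by (simp add: \<eta>_def)
    obtain L :: real where ev: "\<forall>\<^sub>F n in sequentially. \<bar>expectation (T n) - a * Mom n\<bar> \<le>
      \<eta> * Mom n + (1 + a) * (G.m powr (q * n) * prob {\<omega>\<in>space M. (\<epsilon> n)\<^sup>2 * G.Z n \<omega> < L * n})"
      using key[OF \<eta>] by (elim exE)
    have "(\<lambda>n. (1 + a) * (G.m powr (q * n) * prob {\<omega>\<in>space M. (\<epsilon> n)\<^sup>2 * G.Z n \<omega> < L * n})) \<longlonglongrightarrow> (1 + a) * 0"
      by (intro tendsto_intros G.small_population[OF \<epsilon>_pos \<epsilon>_growth q(1)])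
    then have "\<forall>\<^sub>F n in sequentially. (1 + a) * (G.m powr (q * n) * prob {\<omega>\<in>space M. (\<epsilon> n)\<^sup>2 * G.Z n \<omega> < L * n}) < e / 2"
      using e by (intro order_tendstoD(2)[where y=0]) auto
    with ev evB show "\<forall>\<^sub>F n in sequentially. dist (expectation (T n) - a * Mom n) 0 < e"
    proof eventually_elim
      case (elim n)
      have "\<eta> * Mom n \<le> \<eta> * B" using elim \<eta> by (intro mult_left_mono) auto
      also have "\<eta> * B = e / 2" using B by (simp add: \<eta>_def)
      finally show ?case using elim by (simp add: dist_real_def)
    qed
  qed
  from tendsto_add[OF this tendsto_mult[OF tendsto_const[of a] Mom_lim]]
  have "(\<lambda>n. expectation (T n)) \<longlonglongrightarrow> a * I"
    by simp
  moreover have "q - 1 = \<theta> - 2" by (simp add: q_def)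
  ultimately show ?thesis
    unfolding goal_eq I_def G.lap_lim_def by (simp only: q_def)
qed

end
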